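(* Let $F^{(1)},\dots,F^{(s)}$ be pairwise commuting formal power series vector fields on $\mathbb C^n$ of the form $F^{(k)}(x)=\lambda^{(k)}\odot x+\text{(terms of degree at least two)}$, with linearly independent $\lambda^{(1)},\dots,\lambda^{(s)}\in\mathbb C^n$, and let $G^{(1)},\dots,G^{(s)}$ be simultaneous normal forms of them (obtained by one common formal transformation). Assume that the family $F^{(1)},\dots,F^{(s)}$ is maximal formally meromorphic integrable, i.e. it admits $n-s$ independent common formally meromorphic first integrals. Then Condition AL is satisfied: there are formal power series $\check v_{ik}\in\mathbb C[[x_1,\dots,x_n]]$ with $\check v_{ik}(0)=0$ such that $$G^{(k)}(x)=\sum_{i=1}^s\left(\delta_{ik}+\check v_{ik}(x)\right)\lambda^{(i)}\odot x,\qquad 1\le k\le s,$$ where $\delta_{ik}$ is the Kronecker symbol.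
   Context: $\odot$ is the componentwise product. The Lie bracket is $[R,S](x)=DS(x)R(x)-DR(x)S(x)$; commuting means vanishing bracket. With $A^{(k)}x=\lambda^{(k)}\odot x$, commuting fields $G^{(k)}(x)=A^{(k)}x+\cdots$ are in simultaneous normal form if $[A^{(k)}x,G^{(\ell)}(x)]=0$ for all $k,\ell$. A formal transformation is $x=H(y)=y+h(y)$, $h$ with only terms of degree at least two; it transforms $F$ to $\widetilde F$ defined by $DH(y)\widetilde F(y)=F(H(y))$. Formally meromorphic functions are elements of the fraction field $\mathbb C((x_1,\dots,x_n))$ of $\mathbb C[[x_1,\dots,x_n]]$; $\psi$ is a common first integral if $D\psi(x)F^{(k)}(x)=0$ for all $k$; independence means the Jacobian matrix has full rank over $\mathbb C((x_1,\dots,x_n))$. *)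

theory Defs
  imports
    "HOL-Analysis.Analysis"
    "HOL-Computational_Algebra.Fraction_Field"
begin

section \<open>Formal power series in finitely many variables\<close>

text \<open>
  The variables are indexed by the finite type \<open>'n\<close>; a monomial is its exponent
  vector of type \<open>nat ^ 'n\<close>.
\<close>

typedef ('a, 'n::finite) mfps = "UNIV :: (nat ^ 'n \<Rightarrow> 'a) set"
  morphisms mcoeff Abs_mfps
  by simp

setup_lifting type_definition_mfps

lemma mcoeff_Abs_mfps [simp]: "mcoeff (Abs_mfps f) = f"
  by (simp add: Abs_mfps_inverse)

lemmas Abs_mfps_mcoeff [simp] = mcoeff_inverse

lemma mfps_eqI: "(\<And>m. mcoeff f m = mcoeff g m) \<Longrightarrow> f = g"
  by (metis mcoeff_inject ext)

definition mdeg :: "nat ^ 'n \<Rightarrow> nat" where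
  "mdeg m = (\<Sum>i\<in>UNIV. m $ i)"

lemma mdeg_add: "mdeg (p + q) = mdeg p + mdeg q"
  by (simp add: mdeg_def sum.distrib)

lemma le_mdeg: "m $ i \<le> mdeg m"
  unfolding mdeg_def by (rule member_le_sum) auto

lemma finite_mdeg_le: "finite {m :: nat ^ 'n. mdeg m \<le> d}"
proof -
  have "finite (vec_nth -` (UNIV \<rightarrow>\<^sub>E {..d}) :: (nat ^ 'n) set)"
    by (intro finite_vimageI finite_PiE) (auto intro: injI simp: vec_eq_iff)
  moreover have "{m :: nat ^ 'n. mdeg m \<le> d} \<subseteq> vec_nth -` (UNIV \<rightarrow>\<^sub>E {..d})"
    by (auto intro: order_trans[OF le_mdeg])
  ultimately show ?thesis by (rule rev_finite_subset)
qed

definition msplit :: "nat ^ 'n \<Rightarrow> ((nat ^ 'n) \<times> (nat ^ 'n)) set" where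
  "msplit m = {(p, q). p + q = m}"

lemma finite_msplit [simp]: "finite (msplit m)"
proof (rule finite_subset)
  show "msplit m \<subseteq> {p. mdeg p \<le> mdeg m} \<times> {q. mdeg q \<le> mdeg m}"
    by (auto simp: msplit_def mdeg_add)
qed (simp add: finite_mdeg_le)

instantiation mfps :: (comm_ring_1, finite) comm_ring_1
begin

definition "0 = Abs_mfps (\<lambda>_. 0)"
definition "1 = Abs_mfps (\<lambda>m. if m = 0 then 1 else 0)"
definition "f + g = Abs_mfps (\<lambda>m. mcoeff f m + mcoeff g m)"
definition "f - g = Abs_mfps (\<lambda>m. mcoeff f m - mcoeff g m)"
definition "- f = Abs_mfps (\<lambda>m. - mcoeff f m)"
definition "f * g = Abs_mfps (\<lambda>m. \<Sum>(p, q)\<in>msplit m. mcoeff f p * mcoeff g q)"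

instance
proof
  fix f g h :: "('a, 'b) mfps"
  show "f + g + h = f + (g + h)" "f + g = g + f" "0 + f = f" "- f + f = 0" "f - g = f + - g"
    by (simp_all add: plus_mfps_def zero_mfps_def uminus_mfps_def minus_mfps_def algebra_simps)
  show "(0 :: ('a, 'b) mfps) \<noteq> 1"
    by (auto simp: zero_mfps_def one_mfps_def dest: arg_cong[where f = "\<lambda>f. mcoeff f 0"])
  show comm: "f * g = g * f" for f g :: "('a, 'b) mfps"
    unfolding times_mfps_def
    by (intro arg_cong[where f = Abs_mfps] ext
        sum.reindex_bij_witness[where i = prod.swap and j = prod.swap])
       (auto simp: msplit_def algebra_simps)
  show "(f + g) * h = f * h + g * h"
    by (rule mfps_eqI)
       (simp add: times_mfps_def plus_mfps_def algebra_simps case_prod_beta sum.distrib)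
  show "1 * f = f"
  proof (rule mfps_eqI)
    fix m
    have "mcoeff (1 * f) m = (\<Sum>r\<in>msplit m. if r = (0, m) then mcoeff f m else 0)"
      by (auto simp: times_mfps_def one_mfps_def msplit_def intro!: sum.cong)
    also have "\<dots> = mcoeff f m"
      by (simp add: sum.delta) (simp add: msplit_def)
    finally show "mcoeff (1 * f) m = mcoeff f m" .
  qed
  show "f * g * h = f * (g * h)"
  proof (rule mfps_eqI)
    fix m
    have "mcoeff (f * g * h) m =
        (\<Sum>r\<in>msplit m. \<Sum>t\<in>msplit (fst r). mcoeff f (fst t) * mcoeff g (snd t) * mcoeff h (snd r))"
      by (simp add: times_mfps_def case_prod_beta sum_distrib_right)
    also have "\<dots> = (\<Sum>x\<in>Sigma (msplit m) (\<lambda>r. msplit (fst r)).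
        mcoeff f (fst (snd x)) * mcoeff g (snd (snd x)) * mcoeff h (snd (fst x)))"
      by (subst sum.Sigma) (auto simp: case_prod_beta)
    also have "\<dots> = (\<Sum>x\<in>Sigma (msplit m) (\<lambda>r. msplit (snd r)).
        mcoeff f (fst (fst x)) * (mcoeff g (fst (snd x)) * mcoeff h (snd (snd x))))"
      by (rule sum.reindex_bij_witness
          [where i = "\<lambda>((a, b), (c, d)). ((a + c, d), (a, c))"
             and j = "\<lambda>((a, b), (c, d)). ((c, d + b), (d, b))"])
         (auto simp: msplit_def algebra_simps)
    also have "\<dots> = (\<Sum>r\<in>msplit m. \<Sum>t\<in>msplit (snd r).
        mcoeff f (fst r) * (mcoeff g (fst t) * mcoeff h (snd t)))"
      by (subst sum.Sigma) (auto simp: case_prod_beta)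
    also have "\<dots> = mcoeff (f * (g * h)) m"
      by (simp add: times_mfps_def case_prod_beta sum_distrib_left)
    finally show "mcoeff (f * g * h) m = mcoeff (f * (g * h)) m" .
  qed
qed

end

lemma mcoeff_zero [simp]: "mcoeff 0 m = 0"
  and mcoeff_one: "mcoeff 1 m = (if m = 0 then 1 else 0)"
  and mcoeff_add [simp]: "mcoeff (f + g) m = mcoeff f m + mcoeff g m"
  and mcoeff_minus [simp]: "mcoeff (- f) m = - mcoeff f m"
  and mcoeff_diff [simp]: "mcoeff (f - g) m = mcoeff f m - mcoeff g m"
  and mcoeff_mult: "mcoeff (f * g) m = (\<Sum>(p, q)\<in>msplit m. mcoeff f p * mcoeff g q)"
  by (simp_all add: zero_mfps_def one_mfps_def plus_mfps_def uminus_mfps_def minus_mfps_def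
      times_mfps_def)

text \<open>
  There are no zero divisors: the product of the two initial terms with respect to
  a suitable monomial order does not cancel. On monomials of degree less than \<open>B\<close>,
  comparing the numbers with digits \<open>m $ i\<close> in base \<open>B\<close> is such an order.
\<close>

lemma base_digits_inj:
  fixes a b :: "nat \<Rightarrow> nat"
  assumes "(\<Sum>k<n. a k * B ^ k) = (\<Sum>k<n. b k * B ^ k)"
    and "\<And>k. a k < B" "\<And>k. b k < B" "k < n"
  shows "a k = b k"
  using assms
proof (induction n arbitrary: a b k)
  case 0
  then show ?case by simp
next
  case (Suc n)
  have split: "(\<Sum>k<Suc n. c k * B ^ k) = c 0 + B * (\<Sum>k<n. c (Suc k) * B ^ k)" for c :: "nat \<Rightarrow> nat"
    by (simp add: sum.lessThan_Suc_shift sum_distrib_left algebra_simps del: sum.lessThan_Suc)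
  have eq: "a 0 + B * (\<Sum>k<n. a (Suc k) * B ^ k) = b 0 + B * (\<Sum>k<n. b (Suc k) * B ^ k)"
    using Suc.prems(1) by (simp only: split)
  have a0: "a 0 < B" and b0: "b 0 < B"
    using Suc.prems(2,3) by auto
  have 0: "a 0 = b 0"
    using arg_cong[OF eq, of "\<lambda>x. x mod B"] a0 b0 by simp
  with eq a0 have "(\<Sum>k<n. a (Suc k) * B ^ k) = (\<Sum>k<n. b (Suc k) * B ^ k)"
    by simp
  then have "a (Suc j) = b (Suc j)" if "j < n" for j
    using Suc.IH[of "\<lambda>k. a (Suc k)" "\<lambda>k. b (Suc k)" j] Suc.prems(2,3) that by simp
  with 0 Suc.prems(4) show ?case
    by (cases k) auto
qed

instance mfps :: (idom, finite) idom
proof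
  fix f g :: "('a, 'b) mfps"
  assume f: "f \<noteq> 0" and g: "g \<noteq> 0"
  obtain \<sigma> :: "nat \<Rightarrow> 'b" where \<sigma>: "bij_betw \<sigma> {..<CARD('b)} UNIV"
    using ex_bij_betw_nat_finite[of "UNIV :: 'b set"] by (auto simp: atLeast0LessThan)
  have least: "\<exists>m. mcoeff h m \<noteq> 0 \<and> (\<forall>m'. mcoeff h m' \<noteq> 0 \<longrightarrow> r m \<le> r m')"
    if "h \<noteq> 0" for h :: "('a, 'b) mfps" and r :: "nat ^ 'b \<Rightarrow> nat"
  proof -
    from that obtain m where "mcoeff h m \<noteq> 0"
      by (metis mcoeff_zero mfps_eqI)
    then show ?thesis
      using ex_has_least_nat[of "\<lambda>m. mcoeff h m \<noteq> 0" m r] by blast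
  qed
  obtain d where d: "\<And>m. mcoeff f m \<noteq> 0 \<Longrightarrow> mdeg d \<le> mdeg m" and d0: "mcoeff f d \<noteq> 0"
    using least[OF f, of mdeg] by blast
  obtain e where e: "\<And>m. mcoeff g m \<noteq> 0 \<Longrightarrow> mdeg e \<le> mdeg m" and e0: "mcoeff g e \<noteq> 0"
    using least[OF g, of mdeg] by blast
  define B where "B = mdeg d + mdeg e + 1"
  define w :: "nat ^ 'b \<Rightarrow> nat" where "w m = (\<Sum>k<CARD('b). (m $ \<sigma> k) * B ^ k)" for m
  have w_add: "w (p + q) = w p + w q" for p q
    by (simp add: w_def sum.distrib algebra_simps)
  have w_inj: "p = q" if "w p = w q" "mdeg p < B" "mdeg q < B" for p q
  proof (rule vec_eq_iff[THEN iffD2], rule allI)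
    fix i
    obtain k where "k < CARD('b)" "i = \<sigma> k"
      using \<sigma> by (metis UNIV_I bij_betw_imp_surj_on image_iff lessThan_iff)
    then show "p $ i = q $ i"
      using base_digits_inj[of "\<lambda>k. p $ \<sigma> k" B "CARD('b)" "\<lambda>k. q $ \<sigma> k" k] that
      by (metis le_mdeg le_less_trans w_def)
  qed
  have "\<exists>m. (mcoeff f m \<noteq> 0 \<and> mdeg m = mdeg d) \<and>
      (\<forall>m'. mcoeff f m' \<noteq> 0 \<and> mdeg m' = mdeg d \<longrightarrow> w m \<le> w m')"
    using ex_has_least_nat[of "\<lambda>m. mcoeff f m \<noteq> 0 \<and> mdeg m = mdeg d" d w] d0 by blast
  then obtain a where a0: "mcoeff f a \<noteq> 0" and ad: "mdeg a = mdeg d"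
    and a: "\<And>m'. mcoeff f m' \<noteq> 0 \<Longrightarrow> mdeg m' = mdeg d \<Longrightarrow> w a \<le> w m'"
    by blast
  have "\<exists>m. (mcoeff g m \<noteq> 0 \<and> mdeg m = mdeg e) \<and>
      (\<forall>m'. mcoeff g m' \<noteq> 0 \<and> mdeg m' = mdeg e \<longrightarrow> w m \<le> w m')"
    using ex_has_least_nat[of "\<lambda>m. mcoeff g m \<noteq> 0 \<and> mdeg m = mdeg e" e w] e0 by blast
  then obtain b where b0: "mcoeff g b \<noteq> 0" and be: "mdeg b = mdeg e"
    and b: "\<And>m'. mcoeff g m' \<noteq> 0 \<Longrightarrow> mdeg m' = mdeg e \<Longrightarrow> w b \<le> w m'"
    by blast
  have uniq: "p = a \<and> q = b"
    if pq: "p + q = a + b" and p: "mcoeff f p \<noteq> 0" and q: "mcoeff g q \<noteq> 0" for p q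
  proof -
    have "mdeg p + mdeg q = mdeg d + mdeg e"
      using arg_cong[OF pq, of mdeg] ad be by (simp add: mdeg_add)
    with d[OF p] e[OF q] have deg: "mdeg p = mdeg d" "mdeg q = mdeg e"
      by auto
    have "w p + w q = w a + w b"
      using arg_cong[OF pq, of w] by (simp add: w_add)
    with a[OF p deg(1)] b[OF q deg(2)] have "w p = w a" "w q = w b"
      by auto
    with deg ad be show ?thesis
      by (auto simp: B_def intro!: w_inj)
  qed
  have "mcoeff (f * g) (a + b) =
      (\<Sum>r\<in>msplit (a + b). if r = (a, b) then mcoeff f a * mcoeff g b else 0)"
    unfolding mcoeff_mult
  proof (rule sum.cong[OF refl])
    fix r assume "r \<in> msplit (a + b)"
    then show "(case r of (p, q) \<Rightarrow> mcoeff f p * mcoeff g q) =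
        (if r = (a, b) then mcoeff f a * mcoeff g b else 0)"
      using uniq[of "fst r" "snd r"] by (auto simp: msplit_def)
  qed
  also have "\<dots> = mcoeff f a * mcoeff g b"
    by (simp add: sum.delta) (simp add: msplit_def)
  finally show "f * g \<noteq> 0"
    using a0 b0 by auto
qed

definition mconst :: "'a::comm_ring_1 \<Rightarrow> ('a, 'n::finite) mfps" where
  "mconst c = Abs_mfps (\<lambda>m. if m = 0 then c else 0)"

definition mvar :: "'n::finite \<Rightarrow> ('a::comm_ring_1, 'n) mfps" where
  "mvar i = Abs_mfps (\<lambda>m. if m = axis i 1 then 1 else 0)"

definition partial_deriv :: "'n::finite \<Rightarrow> ('a::comm_ring_1, 'n) mfps \<Rightarrow> ('a, 'n) mfps" where
  "partial_deriv i f = Abs_mfps (\<lambda>m. of_nat (m $ i + 1) * mcoeff f (m + axis i 1))"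

lemma mcoeff_partial_deriv:
  "mcoeff (partial_deriv i f) m = of_nat (m $ i + 1) * mcoeff f (m + axis i 1)"
  by (simp add: partial_deriv_def)

lemma partial_deriv_mult: "partial_deriv i (f * g) = partial_deriv i f * g + f * partial_deriv i g"
proof (rule mfps_eqI)
  fix m
  define e :: "nat ^ 'b" where "e = axis i 1"
  have mcoeff_pd: "mcoeff (partial_deriv i h) n = of_nat (n $ i + 1) * mcoeff h (n + e)" for h n
    by (simp add: mcoeff_partial_deriv e_def)
  have drop: "p - e + e = p" if "0 < p $ i" for p :: "nat ^ 'b"
    using that by (auto simp: vec_eq_iff axis_def e_def)
  have e_i: "e $ i = 1"
    by (simp add: axis_def e_def)
  have drop_i: "1 + of_nat ((p - e) $ i) = (of_nat (p $ i) :: 'a)" if "0 < p $ i" for p :: "nat ^ 'b"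
    using that by (metis e_i Suc_pred' of_nat_Suc neq0_conv vector_minus_component One_nat_def)
  have add_shift: "p + e + q = p + q + e" for p q :: "nat ^ 'b"
    by (simp add: add_ac)
  have swap_sub: "p - e + q = m" if "p + q = m + e" "0 < p $ i" for p q :: "nat ^ 'b"
    using that by (auto simp: vec_eq_iff axis_def e_def split: if_splits)
  have 1: "(\<Sum>(p, q)\<in>msplit (m + e). of_nat (p $ i) * (mcoeff f p * mcoeff g q)) =
      mcoeff (partial_deriv i f * g) m"
  proof -
    have "(\<Sum>(p, q)\<in>msplit (m + e). of_nat (p $ i) * (mcoeff f p * mcoeff g q)) =
        (\<Sum>(p, q)\<in>{r \<in> msplit (m + e). fst r $ i > 0}. of_nat (p $ i) * (mcoeff f p * mcoeff g q))"
      by (rule sum.mono_neutral_right) (auto intro!: gr0I)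
    also have "\<dots> = (\<Sum>(p, q)\<in>msplit m. of_nat (p $ i + 1) * mcoeff f (p + e) * mcoeff g q)"
      by (rule sum.reindex_bij_witness
          [where i = "\<lambda>(p, q). (p + e, q)" and j = "\<lambda>(p, q). (p - e, q)"])
         (auto simp: msplit_def drop drop_i swap_sub e_i mult.assoc add_diff_cancel_right' add_shift)
    finally show ?thesis
      by (simp add: mcoeff_mult mcoeff_pd)
  qed
  have 2: "(\<Sum>(p, q)\<in>msplit (m + e). of_nat (q $ i) * (mcoeff f p * mcoeff g q)) =
      mcoeff (f * partial_deriv i g) m"
  proof -
    have swap: "q - e + p = m" "p + (q - e) = m" if "p + q = m + e" "0 < q $ i" for p q :: "nat ^ 'b"
      using swap_sub[of q p] that by (auto simp: add.commute)
    have "(\<Sum>(p, q)\<in>msplit (m + e). of_nat (q $ i) * (mcoeff f p * mcoeff g q)) =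
        (\<Sum>(p, q)\<in>{r \<in> msplit (m + e). snd r $ i > 0}. of_nat (q $ i) * (mcoeff f p * mcoeff g q))"
      by (rule sum.mono_neutral_right) (auto intro!: gr0I)
    also have "\<dots> = (\<Sum>(p, q)\<in>msplit m. mcoeff f p * (of_nat (q $ i + 1) * mcoeff g (q + e)))"
      by (rule sum.reindex_bij_witness
          [where i = "\<lambda>(p, q). (p, q + e)" and j = "\<lambda>(p, q). (p, q - e)"])
         (auto simp: msplit_def drop drop_i swap e_i mult.left_commute add_diff_cancel_right' add.assoc[symmetric])
    finally show ?thesis
      by (simp add: mcoeff_mult mcoeff_pd)
  qed
  have "mcoeff (partial_deriv i (f * g)) m =
      (\<Sum>(p, q)\<in>msplit (m + e). of_nat (m $ i + 1) * (mcoeff f p * mcoeff g q))"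
    by (simp add: mcoeff_pd mcoeff_mult sum_distrib_left case_prod_beta)
  also have "\<dots> = (\<Sum>(p, q)\<in>msplit (m + e). of_nat (p $ i) * (mcoeff f p * mcoeff g q)
      + of_nat (q $ i) * (mcoeff f p * mcoeff g q))"
  proof (rule sum.cong[OF refl], clarify)
    fix p q assume "(p, q) \<in> msplit (m + e)"
    then have "p $ i + q $ i = m $ i + 1"
      by (auto simp: msplit_def e_i vec_eq_iff)
    then show "of_nat (m $ i + 1) * (mcoeff f p * mcoeff g q) =
        of_nat (p $ i) * (mcoeff f p * mcoeff g q) + of_nat (q $ i) * (mcoeff f p * mcoeff g q)"
      by (simp only: of_nat_add distrib_right flip: \<open>p $ i + q $ i = m $ i + 1\<close>)
  qed
  also have "\<dots> = mcoeff (partial_deriv i f * g + f * partial_deriv i g) m"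
    by (simp add: case_prod_beta sum.distrib flip: 1 2)
  finally show "mcoeff (partial_deriv i (f * g)) m =
      mcoeff (partial_deriv i f * g + f * partial_deriv i g) m" .
qed

text \<open>
  Substitution \<open>f(H(y))\<close>, meant for \<open>H(0) = 0\<close>. Then the product
  \<open>\<Prod>i. H $ i ^ (a $ i)\<close> has no terms of degree less than \<open>mdeg a\<close>, so only the
  finitely many \<open>a\<close> with \<open>mdeg a \<le> mdeg m\<close> contribute to the coefficient at \<open>m\<close>.
\<close>

definition msubst :: "('a::comm_ring_1, 'n::finite) mfps \<Rightarrow> ('a, 'n) mfps ^ 'n \<Rightarrow> ('a, 'n) mfps" where
  "msubst f H = Abs_mfps (\<lambda>m. \<Sum>a | mdeg a \<le> mdeg m.
     mcoeff f a * mcoeff (\<Prod>i\<in>UNIV. (H $ i) ^ (a $ i)) m)"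


section \<open>Formally meromorphic functions\<close>

type_synonym ('a, 'n) mfract = "('a, 'n) mfps fract"

lift_definition fract_deriv :: "'n::finite \<Rightarrow> ('a::idom, 'n) mfract \<Rightarrow> ('a, 'n) mfract"
  is "\<lambda>i (f, g). (partial_deriv i f * g - f * partial_deriv i g, g * g)"
proof (clarsimp, goal_cases)
  case (1 i f g f' g')
  have D: "partial_deriv i f * g' + f * partial_deriv i g' = partial_deriv i f' * g + f' * partial_deriv i g"
    using arg_cong[OF 1(3), of "partial_deriv i"] by (simp add: partial_deriv_mult)
  have "(partial_deriv i f * g - f * partial_deriv i g) * (g' * g') - (partial_deriv i f' * g' - f' * partial_deriv i g') * (g * g)
      = g * g' * ((partial_deriv i f * g' + f * partial_deriv i g') - (partial_deriv i f' * g + f' * partial_deriv i g))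
        - (f * g' - f' * g) * (g * partial_deriv i g' + partial_deriv i g * g')"
    by (simp add: algebra_simps)
  also have "\<dots> = 0"
    using D 1(3) by simp
  finally show ?case by simp
qed

lemma fract_deriv_Fract:
  "g \<noteq> 0 \<Longrightarrow> fract_deriv i (Fract f g) = Fract (partial_deriv i f * g - f * partial_deriv i g) (g * g)"
  by transfer simp

definition gradient :: "('a::idom, 'n::finite) mfract \<Rightarrow> ('a, 'n) mfract ^ 'n" where
  "gradient \<psi> = (\<chi> i. fract_deriv i \<psi>)"

text \<open>
  The gradients of \<open>\<psi>\<^sub>1, \<dots>, \<psi>\<^sub>r\<close> are the rows of the Jacobian matrix, whose rank is
  the dimension of the row space as in \<open>row_rank_def_gen\<close>. The constant \<open>rank\<close> is
  not applicable because \<open>r\<close>, which may be \<open>0\<close>, is not the cardinality of a type.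
\<close>

definition jacobian_rank :: "nat \<Rightarrow> (nat \<Rightarrow> ('a::idom, 'n::finite) mfract) \<Rightarrow> nat" where
  "jacobian_rank r \<psi> = vec.dim ((\<lambda>j. gradient (\<psi> j)) ` {1..r})"

definition functionally_independent :: "nat \<Rightarrow> (nat \<Rightarrow> ('a::idom, 'n::finite) mfract) \<Rightarrow> bool" where
  "functionally_independent r \<psi> \<longleftrightarrow> jacobian_rank r \<psi> = r"


section \<open>Formal vector fields\<close>

type_synonym 'n vfield = "(complex, 'n) mfps ^ 'n"

definition Jacobian :: "'n vfield \<Rightarrow> (complex, 'n::finite) mfps ^ 'n ^ 'n" where
  "Jacobian F = (\<chi> i j. partial_deriv j (F $ i))"

definition lie_bracket :: "'n vfield \<Rightarrow> 'n::finite vfield \<Rightarrow> 'n vfield" where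
  "lie_bracket R S = Jacobian S *v R - Jacobian R *v S"

definition diag_field :: "complex ^ 'n \<Rightarrow> 'n::finite vfield" where
  "diag_field \<mu> = (\<chi> i. mconst (\<mu> $ i) * mvar i)"

definition degree_ge2 :: "'n::finite vfield \<Rightarrow> bool" where
  "degree_ge2 h \<longleftrightarrow> (\<forall>i m. mdeg m < 2 \<longrightarrow> mcoeff (h $ i) m = 0)"

definition commuting_family :: "nat \<Rightarrow> (nat \<Rightarrow> complex ^ 'n) \<Rightarrow> (nat \<Rightarrow> 'n::finite vfield) \<Rightarrow> bool" where
  "commuting_family s \<Lambda> F \<longleftrightarrow>
     (\<forall>k\<in>{1..s}. degree_ge2 (F k - diag_field (\<Lambda> k))) \<and>
     (\<forall>k\<in>{1..s}. \<forall>l\<in>{1..s}. lie_bracket (F k) (F l) = 0)"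

definition simultaneous_normal_form ::
    "nat \<Rightarrow> (nat \<Rightarrow> complex ^ 'n) \<Rightarrow> (nat \<Rightarrow> 'n::finite vfield) \<Rightarrow> bool" where
  "simultaneous_normal_form s \<Lambda> G \<longleftrightarrow>
     commuting_family s \<Lambda> G \<and>
     (\<forall>k\<in>{1..s}. \<forall>l\<in>{1..s}. lie_bracket (diag_field (\<Lambda> k)) (G l) = 0)"

definition formal_transformation :: "'n::finite vfield \<Rightarrow> bool" where
  "formal_transformation H \<longleftrightarrow> degree_ge2 (H - (\<chi> i. mvar i))"

definition transforms_to :: "'n vfield \<Rightarrow> 'n vfield \<Rightarrow> 'n::finite vfield \<Rightarrow> bool" where
  "transforms_to H F G \<longleftrightarrow> Jacobian H *v G = (\<chi> i. msubst (F $ i) H)"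

definition common_first_integral ::
    "nat \<Rightarrow> (nat \<Rightarrow> 'n vfield) \<Rightarrow> (complex, 'n::finite) mfract \<Rightarrow> bool" where
  "common_first_integral s F \<psi> \<longleftrightarrow>
     (\<forall>k\<in>{1..s}. (\<Sum>i\<in>UNIV. fract_deriv i \<psi> * Fract (F k $ i) 1) = 0)"

text \<open>
  The condition \<open>r + s = CARD('n)\<close> avoids truncated subtraction in the number
  \<open>CARD('n) - s\<close> of first integrals.
\<close>

definition maximal_meromorphic_integrable :: "nat \<Rightarrow> (nat \<Rightarrow> 'n::finite vfield) \<Rightarrow> bool" where
  "maximal_meromorphic_integrable s F \<longleftrightarrow>
     (\<exists>r \<psi>. r + s = CARD('n) \<and>
        (\<forall>j\<in>{1..r}. common_first_integral s F (\<psi> j)) \<and>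
        functionally_independent r \<psi>)"

definition condition_AL ::
    "nat \<Rightarrow> (nat \<Rightarrow> complex ^ 'n) \<Rightarrow> (nat \<Rightarrow> 'n::finite vfield) \<Rightarrow> bool" where
  "condition_AL s \<Lambda> G \<longleftrightarrow>
     (\<exists>v :: nat \<Rightarrow> nat \<Rightarrow> (complex, 'n) mfps.
        (\<forall>i\<in>{1..s}. \<forall>k\<in>{1..s}. mcoeff (v i k) 0 = 0) \<and>
        (\<forall>k\<in>{1..s}. G k =
           (\<Sum>i=1..s. ((if i = k then 1 else 0) + v i k) *s diag_field (\<Lambda> i))))"

end

theory Submission
  imports Defs
begin

text \<open>
  Let \<open>D\<close> and \<open>A\<close> be the derivations of the power series ring along a normal form
  \<open>G\<^sup>(\<^sup>k\<^sup>)\<close> and along its linear part \<open>\<lambda>\<^sup>(\<^sup>k\<^sup>) \<odot> x\<close>. They commute, \<open>A\<close> is diagonal on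
  monomials, and \<open>D - A\<close> raises the order. Modulo terms of high degree, \<open>A\<close> is therefore
  the semisimple part of \<open>D\<close>, so every space of power series that is invariant under \<open>D\<close> is
  invariant under \<open>A\<close>, up to terms of high degree. If \<open>D(f/g) = 0\<close>, the pairs
  \<open>(u, v)\<close> with \<open>u g = f v\<close> form such a space, which gives \<open>A(f/g) = 0\<close>: a meromorphic
  first integral of a normal form is a first integral of its linear part
  (\<open>first_integral_of_linear_part\<close>).

  Substituting the formal transformation turns the \<open>n - s\<close> first integrals of the
  \<open>F\<^sup>(\<^sup>k\<^sup>)\<close> into first integrals of the \<open>G\<^sup>(\<^sup>k\<^sup>)\<close>, and hence of the linear fields
  \<open>\<lambda>\<^sup>(\<^sup>k\<^sup>) \<odot> x\<close>. Over the field of fractions all these fields lie in the common kernel of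
  \<open>n - s\<close> independent covectors. This kernel has dimension \<open>s\<close> and contains the \<open>s\<close>
  independent linear fields, so each \<open>G\<^sup>(\<^sup>k\<^sup>)\<close> is a combination of them with coefficients
  in that field (\<open>normal_form_in_span_of_linear_parts\<close>).

  It remains to see that the coefficients are power series. Every \<open>c\<close> orthogonal to all
  \<open>\<lambda>\<^sup>(\<^sup>k\<^sup>)\<close> gives the relation \<open>\<Sum>\<^sub>j c\<^sub>j G\<^sub>j / x\<^sub>j = 0\<close>. If \<open>G\<^sub>j\<close> had a monomial \<open>x\<^sup>p\<close> with
  \<open>p\<^sub>j = 0\<close>, no other summand could cancel it, so \<open>c\<^sub>j = 0\<close> for all such \<open>c\<close>, which puts the
  unit vector \<open>e\<^sub>j\<close> into the span of the \<open>\<lambda>\<^sup>(\<^sup>k\<^sup>)\<close>. Then the resonance conditions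
  \<open>\<langle>p, \<lambda>\<^sup>(\<^sup>k\<^sup>)\<rangle> = \<lambda>\<^sup>(\<^sup>k\<^sup>)\<^sub>j\<close> combine to \<open>p\<^sub>j = 1\<close>, a contradiction. Hence \<open>x\<^sub>j\<close> divides
  \<open>G\<^sub>j\<close>, and the relations say that each vector of coefficients of \<open>(G\<^sub>j / x\<^sub>j)\<^sub>j\<close> lies in
  the complex span of the \<open>\<lambda>\<^sup>(\<^sup>k\<^sup>)\<close>. Its coordinates there are the coefficients of the power
  series \<open>\<delta>\<^sub>i\<^sub>k + v\<^sub>i\<^sub>k\<close>.
\<close>

section \<open>Order filtration and monomials\<close>

definition ord_ge :: "nat \<Rightarrow> ('a::comm_ring_1, 'n::finite) mfps \<Rightarrow> bool" where
  "ord_ge d f \<longleftrightarrow> (\<forall>m. mdeg m < d \<longrightarrow> mcoeff f m = 0)"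

lemma ord_ge_0 [simp]: "ord_ge 0 f"
  and ord_ge_zero [simp]: "ord_ge d 0"
  by (simp_all add: ord_ge_def)

lemma ord_ge_mono: "ord_ge e f \<Longrightarrow> d \<le> e \<Longrightarrow> ord_ge d f"
  by (simp add: ord_ge_def)

lemma ord_ge_add: "ord_ge d f \<Longrightarrow> ord_ge d g \<Longrightarrow> ord_ge d (f + g)"
  and ord_ge_diff: "ord_ge d f \<Longrightarrow> ord_ge d g \<Longrightarrow> ord_ge d (f - g)"
  by (simp_all add: ord_ge_def)

lemma ord_ge_sum: "(\<And>i. i \<in> I \<Longrightarrow> ord_ge d (f i)) \<Longrightarrow> ord_ge d (sum f I)"
  by (induction I rule: infinite_finite_induct) (auto intro: ord_ge_add)

lemma ord_ge_all_imp_zero: "(\<And>d. ord_ge d f) \<Longrightarrow> f = 0"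
  by (rule mfps_eqI) (metis ord_ge_def lessI mcoeff_zero)

lemma ord_ge_mult:
  assumes "ord_ge d f" "ord_ge e g"
  shows "ord_ge (d + e) (f * g)"
  unfolding ord_ge_def mcoeff_mult
proof (intro allI impI sum.neutral ballI)
  fix m :: "nat ^ 'b" and x
  assume m: "mdeg m < d + e" and "x \<in> msplit m"
  then have "mdeg (fst x) < d \<or> mdeg (snd x) < e"
    by (auto simp: msplit_def mdeg_add)
  then show "(case x of (p, q) \<Rightarrow> mcoeff f p * mcoeff g q) = 0"
    using assms by (auto simp: ord_ge_def case_prod_beta)
qed

lemma ord_ge_mult_left: "ord_ge d f \<Longrightarrow> ord_ge d (g * f)"
  and ord_ge_mult_right: "ord_ge d f \<Longrightarrow> ord_ge d (f * g)"
  using ord_ge_mult[of 0 g d f] ord_ge_mult[of d f 0 g] by simp_all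

lemma mdeg_axis [simp]: "mdeg (axis i c) = c"
  by (simp add: mdeg_def axis_def)

lemma mdeg_0 [simp]: "mdeg 0 = 0"
  by (simp add: mdeg_def)

lemma ord_ge_partial_deriv: "ord_ge (Suc d) f \<Longrightarrow> ord_ge d (partial_deriv i f)"
  by (auto simp: ord_ge_def mcoeff_partial_deriv mdeg_add)

lemma exponent_induct [case_names zero step]:
  fixes a :: "nat ^ 'n::finite"
  assumes "P 0" and step: "\<And>a j. P a \<Longrightarrow> P (a + axis j 1)"
  shows "P a"
proof (induction "mdeg a" arbitrary: a)
  case 0
  then have "a = 0"
    by (auto simp: vec_eq_iff mdeg_def)
  with assms(1) show ?case by simp
next
  case (Suc d)
  then obtain j where "a $ j > 0"
    by (metis gr0I mdeg_def nat.distinct(1) sum.neutral)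
  then have a: "a = (a - axis j 1) + axis j 1"
    by (auto simp: vec_eq_iff axis_def)
  then have "mdeg a = mdeg (a - axis j 1) + 1"
    using mdeg_add[of "a - axis j 1" "axis j 1"] by simp
  with Suc have "P (a - axis j 1)"
    by simp
  with a show ?case
    using step by metis
qed

definition mmonom :: "'a \<Rightarrow> nat ^ 'n \<Rightarrow> ('a::comm_ring_1, 'n::finite) mfps" where
  "mmonom c a = Abs_mfps (\<lambda>m. if m = a then c else 0)"

lemma mcoeff_mmonom: "mcoeff (mmonom c a) m = (if m = a then c else 0)"
  by (simp add: mmonom_def)

lemma mconst_eq_mmonom: "mconst c = mmonom c 0"
  and mvar_eq_mmonom: "mvar i = mmonom 1 (axis i 1)"
  by (simp_all add: mconst_def mvar_def mmonom_def)

lemma mcoeff_mmonom_mult_add: "mcoeff (mmonom c a * f) (a + m) = c * mcoeff f m"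
proof -
  have "mcoeff (mmonom c a * f) (a + m) =
      (\<Sum>r\<in>msplit (a + m). if r = (a, m) then c * mcoeff f m else 0)"
    unfolding mcoeff_mult by (rule sum.cong[OF refl]) (auto simp: mcoeff_mmonom msplit_def split: if_splits)
  also have "\<dots> = c * mcoeff f m"
    by (simp add: sum.delta) (simp add: msplit_def)
  finally show ?thesis .
qed

lemma mcoeff_mmonom_mult_eq_0:
  assumes "m $ i < a $ i"
  shows "mcoeff (mmonom c a * f) m = 0"
  unfolding mcoeff_mult
proof (rule sum.neutral, safe)
  fix p q assume "(p, q) \<in> msplit m"
  then have "p \<noteq> a"
    using assms by (auto simp: msplit_def)
  then show "mcoeff (mmonom c a) p * mcoeff f q = 0"
    by (simp add: mcoeff_mmonom)
qed

lemma mcoeff_mconst_mult [simp]: "mcoeff (mconst c * f) m = c * mcoeff f m"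
  using mcoeff_mmonom_mult_add[of c 0 f m] by (simp add: mconst_eq_mmonom)

lemma mmonom_mult: "mmonom c a * mmonom d b = mmonom (c * d) (a + b)"
proof (rule mfps_eqI)
  fix m
  show "mcoeff (mmonom c a * mmonom d b) m = mcoeff (mmonom (c * d) (a + b)) m"
  proof (cases "\<forall>i. a $ i \<le> m $ i")
    case True
    then have "m = a + (m - a)"
      by (auto simp: vec_eq_iff)
    then obtain q where "m = a + q" ..
    then show ?thesis
      by (simp add: mcoeff_mmonom_mult_add mcoeff_mmonom)
  next
    case False
    then obtain i where i: "m $ i < a $ i"
      by (auto simp: not_le)
    then have "m \<noteq> a + b"
      by auto
    with i show ?thesis
      by (simp add: mcoeff_mmonom_mult_eq_0 mcoeff_mmonom)
  qed
qed

lemma mconst_0 [simp]: "mconst 0 = 0" and mconst_1 [simp]: "mconst 1 = 1"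
  and mconst_add: "mconst (a + b) = mconst a + mconst b"
  and mconst_mult: "mconst (a * b) = mconst a * mconst b"
  by (auto intro!: mfps_eqI simp: mconst_eq_mmonom mcoeff_mmonom mcoeff_one mmonom_mult)

lemma mconst_sum: "mconst (sum f I) = (\<Sum>i\<in>I. mconst (f i))"
  by (induction I rule: infinite_finite_induct) (simp_all add: mconst_add)

lemma mcoeff_sum: "mcoeff (sum f I) m = (\<Sum>i\<in>I. mcoeff (f i) m)"
  by (induction I rule: infinite_finite_induct) simp_all

lemma ord_ge_mmonom: "ord_ge (mdeg a) (mmonom c a)"
  by (auto simp: ord_ge_def mcoeff_mmonom)

lemma ord_ge_diff_truncation:
  "ord_ge (Suc d) (f - (\<Sum>a | mdeg a \<le> d. mmonom (mcoeff f a) a))"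
  unfolding ord_ge_def
  by (auto simp: mcoeff_sum mcoeff_mmonom sum.delta finite_mdeg_le)

lemma partial_deriv_add: "partial_deriv i (f + g) = partial_deriv i f + partial_deriv i g"
  and partial_deriv_diff: "partial_deriv i (f - g) = partial_deriv i f - partial_deriv i g"
  and partial_deriv_0 [simp]: "partial_deriv i 0 = 0"
  by (rule mfps_eqI, simp add: mcoeff_partial_deriv algebra_simps)+

lemma partial_deriv_mconst [simp]:
  "partial_deriv i (mconst c :: ('a::comm_ring_1, 'b::finite) mfps) = 0"
proof (rule mfps_eqI)
  fix m :: "nat ^ 'b"
  have "m + axis i 1 \<noteq> 0"
    by (metis mdeg_add mdeg_0 mdeg_axis add_is_0 one_neq_zero)
  then show "mcoeff (partial_deriv i (mconst c)) m = mcoeff 0 m"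
    by (simp add: mcoeff_partial_deriv mconst_def)
qed

lemma partial_deriv_mvar:
  "partial_deriv i (mvar j :: ('a::comm_ring_1, 'b::finite) mfps) = (if i = j then 1 else 0)"
proof (rule mfps_eqI)
  fix m :: "nat ^ 'b"
  have "m + axis i 1 = axis j 1 \<longleftrightarrow> m = 0 \<and> i = j"
  proof
    assume *: "m + axis i 1 = (axis j 1 :: nat ^ 'b)"
    then have "mdeg m + 1 = 1"
      by (metis mdeg_add mdeg_axis)
    then have "m = 0"
      by (auto simp: mdeg_def vec_eq_iff)
    with * show "m = 0 \<and> i = j"
      by (auto simp: axis_eq_axis)
  qed auto
  then show "mcoeff (partial_deriv i (mvar j)) m = mcoeff (if i = j then 1 else 0) m"
    by (auto simp: mcoeff_partial_deriv mvar_def mcoeff_one)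
qed

section \<open>Substitution of a formal transformation\<close>

definition mpow :: "('a::comm_ring_1, 'n::finite) mfps ^ 'n \<Rightarrow> nat ^ 'n \<Rightarrow> ('a, 'n) mfps" where
  "mpow H a = (\<Prod>i\<in>UNIV. (H $ i) ^ (a $ i))"

lemma mpow_0 [simp]: "mpow H 0 = 1"
  and mpow_add: "mpow H (a + b) = mpow H a * mpow H b"
  by (simp_all add: mpow_def power_add prod.distrib)

lemma mpow_axis [simp]: "mpow H (axis j 1) = H $ j"
proof -
  have "mpow H (axis j 1) = (\<Prod>i\<in>UNIV. if i = j then H $ j else 1)"
    unfolding mpow_def by (rule prod.cong) (auto simp: axis_def)
  then show ?thesis
    by simp
qed

text \<open>
  Without constant terms in \<open>H\<close>, the order of \<open>H\<^sup>a\<close> is at least the degree of \<open>a\<close>. This is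
  what makes \<open>f(H)\<close> a formally convergent sum and allows identities for it to be checked on
  truncations of \<open>f\<close>.
\<close>

locale vanishing_substitution =
  fixes H :: "('a::comm_ring_1, 'n::finite) mfps ^ 'n"
  assumes ord_ge_subst: "ord_ge 1 (H $ i)"
begin

lemma ord_ge_mpow: "ord_ge (mdeg a) (mpow H a)"
proof (induction a rule: exponent_induct)
  case (step a j)
  then show ?case
    using ord_ge_mult[OF step ord_ge_subst] by (simp add: mdeg_add mpow_add del: One_nat_def)
qed simp

lemma ord_ge_msubst_diff_truncation:
  "ord_ge (Suc d) (msubst f H - (\<Sum>a | mdeg a \<le> d. mconst (mcoeff f a) * mpow H a))"
  unfolding ord_ge_def
proof (intro allI impI)
  fix m :: "nat ^ 'n"
  assume "mdeg m < Suc d"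
  then have "(\<Sum>a | mdeg a \<le> mdeg m. mcoeff f a * mcoeff (mpow H a) m) =
      (\<Sum>a | mdeg a \<le> d. mcoeff f a * mcoeff (mpow H a) m)"
    by (intro sum.mono_neutral_left finite_mdeg_le)
       (use ord_ge_mpow in \<open>auto simp: ord_ge_def not_le\<close>)
  then show "mcoeff (msubst f H - (\<Sum>a | mdeg a \<le> d. mconst (mcoeff f a) * mpow H a)) m = 0"
    by (simp add: msubst_def mcoeff_sum mpow_def)
qed

lemma ord_ge_msubst: "ord_ge d f \<Longrightarrow> ord_ge d (msubst f H)"
  by (auto simp: ord_ge_def msubst_def intro!: sum.neutral)

lemma msubst_add: "msubst (f + g) H = msubst f H + msubst g H"
  and msubst_diff: "msubst (f - g) H = msubst f H - msubst g H"
  and msubst_0 [simp]: "msubst 0 H = 0"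
  by (rule mfps_eqI, simp add: msubst_def algebra_simps sum.distrib sum_subtractf)+

lemma msubst_mmonom: "msubst (mmonom c a) H = mconst c * mpow H a"
proof (rule mfps_eqI)
  fix m :: "nat ^ 'n"
  have "mcoeff (mpow H a) m = 0" if "\<not> mdeg a \<le> mdeg m"
    using that ord_ge_mpow[of a] by (auto simp: ord_ge_def)
  moreover have "mcoeff (msubst (mmonom c a) H) m =
      (\<Sum>b | mdeg b \<le> mdeg m. if b = a then c * mcoeff (mpow H a) m else 0)"
    unfolding msubst_def mcoeff_Abs_mfps
    by (rule sum.cong) (auto simp: mcoeff_mmonom mpow_def)
  ultimately show "mcoeff (msubst (mmonom c a) H) m = mcoeff (mconst c * mpow H a) m"
    by (auto simp: sum.delta finite_mdeg_le)
qed

lemma msubst_mconst [simp]: "msubst (mconst c) H = mconst c"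
  and msubst_mvar [simp]: "msubst (mvar j) H = H $ j"
  and msubst_1 [simp]: "msubst 1 H = 1"
  using msubst_mmonom[of 1 0]
  by (simp_all add: msubst_mmonom mconst_eq_mmonom mvar_eq_mmonom mpow_axis[simplified]
      flip: mconst_1) (simp_all add: mconst_eq_mmonom[symmetric])

text \<open>
  Up to degree \<open>d\<close>, the series \<open>f(H)\<close> and \<open>g(H)\<close> agree with the finite sums over exponents
  of degree at most \<open>d\<close>. The product of these sums differs from the sum for \<open>f g\<close> only by
  terms \<open>H\<^sup>p H\<^sup>q\<close> with \<open>p + q\<close> of degree greater than \<open>d\<close>, which have order greater than \<open>d\<close>.
\<close>

lemma msubst_mult: "msubst (f * g) H = msubst f H * msubst g H"
proof -
  define T where "T d h = (\<Sum>a | mdeg a \<le> d. mconst (mcoeff h a) * mpow H a)"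
    for d and h :: "('a, 'n) mfps"
  have T: "ord_ge (Suc d) (msubst h H - T d h)" for d h
    using ord_ge_msubst_diff_truncation by (simp add: T_def)
  have "ord_ge (Suc d) (msubst (f * g) H - msubst f H * msubst g H)" for d
  proof -
    define D where "D = {a :: nat ^ 'n. mdeg a \<le> d}"
    define t where "t r = mconst (mcoeff f (fst r)) * mpow H (fst r) *
        (mconst (mcoeff g (snd r)) * mpow H (snd r))" for r
    have finD: "finite D"
      by (simp add: D_def finite_mdeg_le)
    have "T d (f * g) = (\<Sum>a\<in>D. \<Sum>r\<in>msplit a. t r)"
      unfolding T_def D_def
    proof (rule sum.cong[OF refl])
      fix a :: "nat ^ 'n"
      show "mconst (mcoeff (f * g) a) * mpow H a = (\<Sum>r\<in>msplit a. t r)"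
        unfolding mcoeff_mult mconst_sum sum_distrib_right
        by (rule sum.cong[OF refl])
           (auto simp: msplit_def t_def mpow_add mconst_mult algebra_simps)
    qed
    also have "\<dots> = (\<Sum>x\<in>Sigma D msplit. t (snd x))"
      using finD by (subst sum.Sigma) (auto simp: case_prod_beta)
    also have "\<dots> = (\<Sum>r | fst r + snd r \<in> D. t r)"
      by (rule sum.reindex_bij_witness[where i = "\<lambda>r. (fst r + snd r, r)" and j = snd])
         (auto simp: msplit_def)
    finally have fg: "T d (f * g) = (\<Sum>r | fst r + snd r \<in> D. t r)" .
    have "T d f * T d g = (\<Sum>r\<in>D \<times> D. t r)"
      by (simp add: T_def D_def t_def sum_product sum.cartesian_product case_prod_beta)
    also have "\<dots> = (\<Sum>r | fst r + snd r \<in> D. t r) + (\<Sum>r\<in>D \<times> D - {r. fst r + snd r \<in> D}. t r)"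
      using finD by (subst sum.subset_diff[of "{r. fst r + snd r \<in> D}"])
        (auto simp: D_def mdeg_add)
    finally have "T d f * T d g - T d (f * g) = (\<Sum>r\<in>D \<times> D - {r. fst r + snd r \<in> D}. t r)"
      by (simp add: fg)
    moreover have "ord_ge (Suc d) (t r)" if "r \<in> D \<times> D - {r. fst r + snd r \<in> D}" for r
    proof -
      have "ord_ge (mdeg (fst r) + mdeg (snd r)) (t r)"
        unfolding t_def by (intro ord_ge_mult ord_ge_mult_left ord_ge_mpow)
      with that show ?thesis
        by (auto simp: D_def mdeg_add intro: ord_ge_mono)
    qed
    ultimately have TT: "ord_ge (Suc d) (T d f * T d g - T d (f * g))"
      by (simp only:) (rule ord_ge_sum)
    have "msubst (f * g) H - msubst f H * msubst g H =
        (msubst (f * g) H - T d (f * g)) - (T d f * T d g - T d (f * g))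
        - ((msubst f H - T d f) * msubst g H + T d f * (msubst g H - T d g))"
      by (simp add: algebra_simps)
    then show ?thesis
      by (simp only:) (intro T TT ord_ge_diff ord_ge_add ord_ge_mult_left ord_ge_mult_right)
  qed
  then have "ord_ge d (msubst (f * g) H - msubst f H * msubst g H)" for d
    using ord_ge_mono[of "Suc d"] by fastforce
  then show ?thesis
    using ord_ge_all_imp_zero by fastforce
qed

text \<open>
  Chain rule. The difference \<open>E\<close> of the two sides is a derivation over the substitution
  homomorphism that kills constants and variables, hence all polynomials, and it lowers
  the order by at most one. So \<open>E f\<close> has arbitrarily high order.
\<close>

lemma partial_deriv_msubst:
  "partial_deriv i (msubst f H) =
     (\<Sum>j\<in>UNIV. msubst (partial_deriv j f) H * partial_deriv i (H $ j))"
proof -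
  define E where "E f = partial_deriv i (msubst f H) -
      (\<Sum>j\<in>UNIV. msubst (partial_deriv j f) H * partial_deriv i (H $ j))" for f
  have E_diff: "E (f - g) = E f - E g" for f g
    by (simp add: E_def msubst_diff partial_deriv_diff algebra_simps sum_subtractf)
  have E_add: "E (f + g) = E f + E g" for f g
    by (simp add: E_def msubst_add partial_deriv_add algebra_simps sum.distrib)
  have E_0: "E 0 = 0"
    by (simp add: E_def)
  have E_sum: "E (sum h I) = (\<Sum>a\<in>I. E (h a))" for h and I :: "(nat ^ 'n) set"
    by (induction I rule: infinite_finite_induct) (simp_all add: E_add E_0)
  have E_mult: "E (f * g) = E f * msubst g H + msubst f H * E g" for f g
    by (simp add: E_def msubst_mult msubst_add partial_deriv_mult algebra_simps sum.distrib
        sum_distrib_left)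
  have E_mvar: "E (mvar j) = 0" for j
  proof -
    have "(\<Sum>k\<in>UNIV. msubst (partial_deriv k (mvar j)) H * partial_deriv i (H $ k)) =
        (\<Sum>k\<in>UNIV. if k = j then partial_deriv i (H $ j) else 0)"
      by (rule sum.cong) (auto simp: partial_deriv_mvar)
    then show ?thesis
      by (simp add: E_def)
  qed
  have E_mmonom: "E (mmonom c a) = 0" for c a
  proof (induction a rule: exponent_induct)
    case zero
    then show ?case
      by (simp add: E_def flip: mconst_eq_mmonom)
  next
    case (step a j)
    have "mmonom c (a + axis j 1) = mmonom c a * mvar j"
      by (simp add: mvar_eq_mmonom mmonom_mult)
    with step show ?case
      by (simp add: E_mult E_mvar)
  qed
  have E_ord: "ord_ge d (E h)" if "ord_ge (Suc d) h" for d h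
    unfolding E_def
    by (intro ord_ge_diff ord_ge_sum ord_ge_mult_right ord_ge_partial_deriv ord_ge_msubst that)
  have "ord_ge d (E f)" for d
    using E_ord[OF ord_ge_diff_truncation[of d f]] by (simp add: E_diff E_sum E_mmonom)
  then have "E f = 0"
    by (rule ord_ge_all_imp_zero)
  then show ?thesis
    by (simp add: E_def)
qed

end

text \<open>
  A formal transformation is tangent to the identity, so \<open>f\<close> and \<open>f(H)\<close> have the same
  terms of lowest degree.
\<close>

lemma msubst_eq_0_iff:
  fixes f :: "(complex, 'n::finite) mfps"
  assumes "formal_transformation H"
  shows "msubst f H = 0 \<longleftrightarrow> f = 0"
proof -
  have H: "ord_ge 2 (H $ i - mvar i)" for i
    using assms by (simp add: formal_transformation_def degree_ge2_def ord_ge_def)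
  have var: "ord_ge 1 (mvar i :: (complex, 'n) mfps)" for i
    using ord_ge_mmonom[of "axis i 1"] by (simp add: mvar_eq_mmonom)
  have H1: "ord_ge 1 (H $ i)" for i
    using ord_ge_add[OF ord_ge_mono[OF H[of i], of 1] var[of i]] by simp
  interpret vanishing_substitution H
    by unfold_locales (rule H1)
  \<comment> \<open>Since \<open>H\<close> is tangent to the identity, the leading term of \<open>H\<^sup>a\<close> is \<open>x\<^sup>a\<close>.\<close>
  have lead: "ord_ge (Suc (mdeg a)) (mpow H a - mmonom 1 a)" for a
  proof (induction a rule: exponent_induct)
    case zero
    show ?case
      by (simp flip: mconst_eq_mmonom)
  next
    case (step a j)
    have "mpow H (a + axis j 1) - mmonom 1 (a + axis j 1) =
        (mpow H a - mmonom 1 a) * H $ j + mmonom 1 a * (H $ j - mvar j)"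
      by (simp only: mpow_add mpow_axis mvar_eq_mmonom mmonom_mult algebra_simps mult_1)
    moreover have "ord_ge (Suc (mdeg a) + 1) ((mpow H a - mmonom 1 a) * H $ j)"
      by (intro ord_ge_mult step H1)
    moreover have "ord_ge (mdeg a + 2) (mmonom 1 a * (H $ j - mvar j))"
      by (intro ord_ge_mult ord_ge_mmonom H)
    ultimately show ?case
      by (simp add: ord_ge_add mdeg_add)
  qed
  have "msubst f H \<noteq> 0" if "f \<noteq> 0"
  proof -
    from that obtain m0 where "mcoeff f m0 \<noteq> 0"
      by (metis mcoeff_zero mfps_eqI)
    then obtain m where m: "mcoeff f m \<noteq> 0" and min: "\<And>a. mcoeff f a \<noteq> 0 \<Longrightarrow> mdeg m \<le> mdeg a"
      using ex_has_least_nat[of "\<lambda>m. mcoeff f m \<noteq> 0" m0 mdeg] by blast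
    have "mcoeff (msubst f H) m = (\<Sum>a | mdeg a \<le> mdeg m. if a = m then mcoeff f m else 0)"
      unfolding msubst_def mcoeff_Abs_mfps mpow_def[symmetric]
    proof (rule sum.cong[OF refl])
      fix a :: "nat ^ 'n" assume a: "a \<in> {a. mdeg a \<le> mdeg m}"
      show "mcoeff f a * mcoeff (mpow H a) m = (if a = m then mcoeff f m else 0)"
      proof (cases "mcoeff f a = 0")
        case False
        with min a have "mdeg a = mdeg m"
          by (simp add: le_antisym)
        then have "mcoeff (mpow H a - mmonom 1 a) m = 0"
          using lead[of a] by (simp add: ord_ge_def)
        then show ?thesis
          by (auto simp: mcoeff_mmonom)
      qed (use m in auto)
    qed
    then have "mcoeff (msubst f H) m = mcoeff f m"
      by (simp add: finite_mdeg_le sum.delta)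
    with m show ?thesis
      by auto
  qed
  then show ?thesis
    by auto
qed

section \<open>Lie derivatives and resonant vector fields\<close>

definition lie_deriv :: "('a::comm_ring_1, 'n::finite) mfps ^ 'n \<Rightarrow> ('a, 'n) mfps \<Rightarrow> ('a, 'n) mfps" where
  "lie_deriv X f = (\<Sum>i\<in>UNIV. partial_deriv i f * X $ i)"

lemma lie_deriv_add: "lie_deriv X (f + g) = lie_deriv X f + lie_deriv X g"
  and lie_deriv_diff: "lie_deriv X (f - g) = lie_deriv X f - lie_deriv X g"
  and lie_deriv_mult: "lie_deriv X (f * g) = lie_deriv X f * g + f * lie_deriv X g"
  and lie_deriv_field_diff: "lie_deriv (X - Y) f = lie_deriv X f - lie_deriv Y f"
  by (simp_all add: lie_deriv_def partial_deriv_add partial_deriv_diff partial_deriv_mult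
      algebra_simps sum.distrib sum_subtractf sum_distrib_left)

lemma lie_deriv_mconst_mult: "lie_deriv X (mconst c * f) = mconst c * lie_deriv X f"
  by (simp add: lie_deriv_mult) (simp add: lie_deriv_def)

lemma ord_ge_lie_deriv:
  assumes "\<And>i. ord_ge 1 (X $ i)" and "ord_ge d f"
  shows "ord_ge d (lie_deriv X f)"
  unfolding lie_deriv_def
proof (intro ord_ge_sum)
  fix i
  show "ord_ge d (partial_deriv i f * X $ i)"
  proof (cases d)
    case (Suc e)
    then show ?thesis
      using ord_ge_mult[OF ord_ge_partial_deriv assms(1), of e f i i] assms(2) by simp
  qed simp
qed

lemma ord_ge_Suc_lie_deriv:
  assumes "\<And>i. ord_ge 2 (X $ i)" and "ord_ge d f"
  shows "ord_ge (Suc d) (lie_deriv X f)"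
  unfolding lie_deriv_def
proof (intro ord_ge_sum)
  fix i
  show "ord_ge (Suc d) (partial_deriv i f * X $ i)"
  proof (cases d)
    case 0
    then show ?thesis
      using ord_ge_mult_left[OF ord_ge_mono[OF assms(1)[of i], of 1]] by simp
  next
    case (Suc e)
    then show ?thesis
      using ord_ge_mult[OF ord_ge_partial_deriv assms(1), of e f i i] assms(2) by simp
  qed
qed

text \<open>
  The pairing \<open>\<langle>m, \<mu>\<rangle>\<close>, which is the eigenvalue of the derivation along \<open>\<mu> \<odot> x\<close> on \<open>x\<^sup>m\<close>.
\<close>

definition weight :: "complex ^ 'n::finite \<Rightarrow> nat ^ 'n \<Rightarrow> complex" where
  "weight \<mu> m = (\<Sum>i\<in>UNIV. \<mu> $ i * of_nat (m $ i))"

lemma weight_add: "weight \<mu> (p + q) = weight \<mu> p + weight \<mu> q"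
  by (simp add: weight_def algebra_simps sum.distrib)

lemma weight_axis: "weight \<mu> (axis i 1) = \<mu> $ i"
proof -
  have "weight \<mu> (axis i 1) = (\<Sum>j\<in>UNIV. if j = i then \<mu> $ i else 0)"
    unfolding weight_def by (rule sum.cong) (auto simp: axis_def)
  then show ?thesis by simp
qed

lemma mcoeff_lie_deriv_diag_field:
  "mcoeff (lie_deriv (diag_field \<mu>) f) m = weight \<mu> m * mcoeff f m"
proof -
  have "mcoeff (partial_deriv i f * diag_field \<mu> $ i) m = \<mu> $ i * of_nat (m $ i) * mcoeff f m" for i
  proof -
    have eq: "partial_deriv i f * diag_field \<mu> $ i = mmonom (\<mu> $ i) (axis i 1) * partial_deriv i f"
      by (simp add: diag_field_def mconst_eq_mmonom mvar_eq_mmonom mmonom_mult mult.commute)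
    show ?thesis
    proof (cases "m $ i = 0")
      case True
      then show ?thesis
        unfolding eq by (simp add: mcoeff_mmonom_mult_eq_0[of _ i] axis_def)
    next
      case False
      then have "m = axis i 1 + (m - axis i 1)"
        by (auto simp: vec_eq_iff axis_def)
      then obtain q where q: "m = axis i 1 + q" ..
      show ?thesis
        unfolding eq q mcoeff_mmonom_mult_add mcoeff_partial_deriv
        by (simp add: axis_def add.commute)
    qed
  qed
  then show ?thesis
    by (simp add: lie_deriv_def mcoeff_sum weight_def sum_distrib_right)
qed

lemma lie_bracket_component:
  "lie_bracket R S $ i = lie_deriv R (S $ i) - lie_deriv S (R $ i)"
  by (simp add: lie_bracket_def Jacobian_def matrix_vector_mult_def lie_deriv_def)

text \<open>
  Commuting with \<open>\<mu> \<odot> x\<close> makes the component \<open>G\<^sub>i\<close> an eigenvector of the derivation along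
  \<open>\<mu> \<odot> x\<close> with eigenvalue \<open>\<mu>\<^sub>i\<close>.
\<close>

lemma resonant_if_commutes_diag_field:
  assumes "lie_bracket (diag_field \<mu>) G = 0" and "mcoeff (G $ i) m \<noteq> 0"
  shows "weight \<mu> m = \<mu> $ i"
proof -
  have "lie_deriv G (diag_field \<mu> $ i) = mconst (\<mu> $ i) * G $ i"
  proof -
    have "lie_deriv G (diag_field \<mu> $ i) =
        (\<Sum>j\<in>UNIV. if j = i then mconst (\<mu> $ i) * G $ i else 0)"
      unfolding lie_deriv_def
      by (rule sum.cong) (auto simp: diag_field_def partial_deriv_mult partial_deriv_mvar)
    then show ?thesis by simp
  qed
  then have "mcoeff (lie_deriv (diag_field \<mu>) (G $ i)) m = \<mu> $ i * mcoeff (G $ i) m"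
    using assms(1) lie_bracket_component[of "diag_field \<mu>" G i] by simp
  with assms(2) show ?thesis
    by (simp add: mcoeff_lie_deriv_diag_field)
qed


section \<open>First integrals of a normal form and of its linear part\<close>

text \<open>
  The projection to the eigenspace for \<open>\<alpha>\<close> of the derivation along \<open>\<mu> \<odot> x\<close>.
\<close>

definition weight_component :: "complex ^ 'n::finite \<Rightarrow> complex \<Rightarrow> (complex, 'n) mfps \<Rightarrow> (complex, 'n) mfps" where
  "weight_component \<mu> \<alpha> f = Abs_mfps (\<lambda>m. if weight \<mu> m = \<alpha> then mcoeff f m else 0)"

lemma mcoeff_weight_component:
  "mcoeff (weight_component \<mu> \<alpha> f) m = (if weight \<mu> m = \<alpha> then mcoeff f m else 0)"
  by (simp add: weight_component_def)

lemma weight_component_diff: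
    "weight_component \<mu> \<alpha> (f - g) = weight_component \<mu> \<alpha> f - weight_component \<mu> \<alpha> g"
  and weight_component_mconst_mult:
    "weight_component \<mu> \<alpha> (mconst c * f) = mconst c * weight_component \<mu> \<alpha> f"
  and weight_component_idem:
    "weight_component \<mu> \<alpha> (weight_component \<mu> \<alpha> f) = weight_component \<mu> \<alpha> f"
  by (auto intro!: mfps_eqI simp: mcoeff_weight_component)

text \<open>
  The term \<open>x\<^sup>q\<close> of \<open>G\<^sub>i\<close> has weight \<open>\<mu>\<^sub>i\<close>, and \<open>\<partial>\<^sub>i\<close> lowers weights by \<open>\<mu>\<^sub>i\<close>, so the derivation
  along \<open>G\<close> preserves weights.
\<close>

lemma lie_deriv_weight_component:
  assumes "lie_bracket (diag_field \<mu>) G = 0"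
  shows "lie_deriv G (weight_component \<mu> \<alpha> f) = weight_component \<mu> \<alpha> (lie_deriv G f)"
proof (rule mfps_eqI)
  fix m
  have "mcoeff (partial_deriv i (weight_component \<mu> \<alpha> f)) p * mcoeff (G $ i) q =
      (if weight \<mu> m = \<alpha> then mcoeff (partial_deriv i f) p * mcoeff (G $ i) q else 0)"
    if "(p, q) \<in> msplit m" for i p q
  proof (cases "mcoeff (G $ i) q = 0")
    case False
    then have "weight \<mu> q = \<mu> $ i"
      using assms by (rule resonant_if_commutes_diag_field[rotated])
    then have "weight \<mu> (p + axis i 1) = weight \<mu> m"
      using that by (auto simp: msplit_def weight_add weight_axis[simplified])
    then show ?thesis
      by (simp add: mcoeff_partial_deriv mcoeff_weight_component)
  qed auto
  then have "mcoeff (partial_deriv i (weight_component \<mu> \<alpha> f) * G $ i) m =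
      (if weight \<mu> m = \<alpha> then mcoeff (partial_deriv i f * G $ i) m else 0)" for i
    unfolding mcoeff_mult
    by (cases "weight \<mu> m = \<alpha>") (auto intro!: sum.cong sum.neutral)
  then show "mcoeff (lie_deriv G (weight_component \<mu> \<alpha> f)) m =
      mcoeff (weight_component \<mu> \<alpha> (lie_deriv G f)) m"
    by (simp add: lie_deriv_def mcoeff_sum mcoeff_weight_component)
qed


locale diagonal_normal_form =
  fixes \<mu> :: "complex ^ 'n::finite" and G :: "'n vfield"
  assumes higher: "degree_ge2 (G - diag_field \<mu>)"
    and commutes: "lie_bracket (diag_field \<mu>) G = 0"
begin

definition shifted :: "complex \<Rightarrow> (complex, 'n) mfps \<Rightarrow> (complex, 'n) mfps" where
  "shifted \<beta> f = lie_deriv G f - mconst \<beta> * f"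

lemma ord_ge_2_nonlinear_part: "ord_ge 2 ((G - diag_field \<mu>) $ i)"
  using higher by (simp add: degree_ge2_def ord_ge_def)

lemma ord_ge_1_field: "ord_ge 1 (G $ i)"
proof -
  have "ord_ge 1 (mvar i :: (complex, 'n) mfps)"
    using ord_ge_mmonom[of "axis i 1" 1] by (simp add: mvar_eq_mmonom)
  then have "ord_ge 1 (diag_field \<mu> $ i)"
    by (simp add: diag_field_def ord_ge_mult_left)
  then show ?thesis
    using ord_ge_add[OF ord_ge_mono[OF ord_ge_2_nonlinear_part[of i], of 1]] by fastforce
qed

lemma weight_component_shifted:
  "weight_component \<mu> \<alpha> (shifted \<beta> f) = shifted \<beta> (weight_component \<mu> \<alpha> f)"
  by (simp add: shifted_def weight_component_diff weight_component_mconst_mult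
      lie_deriv_weight_component[OF commutes])

lemma shifted_commute: "shifted \<alpha> (shifted \<beta> f) = shifted \<beta> (shifted \<alpha> f)"
  by (simp add: shifted_def lie_deriv_diff lie_deriv_mconst_mult) (simp add: algebra_simps)

text \<open>
  On the eigenspace for \<open>\<beta>\<close> the linear part of \<open>G\<close> acts as \<open>\<beta>\<close>, so subtracting \<open>\<beta>\<close> leaves the
  derivation along the terms of degree at least two.
\<close>

lemma ord_ge_Suc_shifted:
  assumes "weight_component \<mu> \<beta> f = f" and "ord_ge d f"
  shows "ord_ge (Suc d) (shifted \<beta> f)"
proof -
  have "mcoeff (lie_deriv (diag_field \<mu>) f) m = mcoeff (mconst \<beta> * f) m" for m
    using arg_cong[OF assms(1), of "\<lambda>f. mcoeff f m"]
    by (auto simp: mcoeff_lie_deriv_diag_field mcoeff_weight_component split: if_splits)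
  then have "shifted \<beta> f = lie_deriv (G - diag_field \<mu>) f"
    by (simp add: shifted_def lie_deriv_field_diff mfps_eqI)
  then show ?thesis
    using ord_ge_Suc_lie_deriv[OF ord_ge_2_nonlinear_part assms(2)] by simp
qed

lemma weight_component_funpow_shifted:
  "weight_component \<mu> \<alpha> ((shifted \<beta> ^^ k) f) = (shifted \<beta> ^^ k) (weight_component \<mu> \<alpha> f)"
  by (induction k) (simp_all add: weight_component_shifted)

lemma ord_ge_funpow_shifted:
  assumes "weight_component \<mu> \<beta> f = f"
  shows "ord_ge k ((shifted \<beta> ^^ k) f)"
proof (induction k)
  case (Suc k)
  then show ?case
    using ord_ge_Suc_shifted[of \<beta> "(shifted \<beta> ^^ k) f"] assms
    by (simp add: weight_component_funpow_shifted)
qed simp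

lemma shifted_sum: "shifted \<beta> (sum f I) = (\<Sum>i\<in>I. shifted \<beta> (f i))"
proof -
  have "shifted \<beta> (f + g) = shifted \<beta> f + shifted \<beta> g" for f g
    by (simp add: shifted_def lie_deriv_add algebra_simps)
  moreover have "shifted \<beta> 0 = 0"
    by (simp add: shifted_def lie_deriv_def)
  ultimately show ?thesis
    by (induction I rule: infinite_finite_induct) simp_all
qed

lemma funpow_shifted_sum: "(shifted \<beta> ^^ k) (sum f I) = (\<Sum>i\<in>I. (shifted \<beta> ^^ k) (f i))"
  by (induction k) (simp_all add: shifted_sum)

text \<open>
  The relation \<open>R\<close> is a space of pairs of power series that is invariant under the
  derivation \<open>D\<close> along \<open>G\<close> and contains all pairs of order at least \<open>d\<close>. On pairs modulo that
  order \<open>D\<close> has finitely many generalized eigenspaces, the weight components, and \<open>R\<close> is shown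
  to contain the components of each of its elements.
\<close>

context
  fixes R :: "(complex, 'n) mfps \<Rightarrow> (complex, 'n) mfps \<Rightarrow> bool" and d :: nat
  assumes R_diff: "\<And>u v u' v'. R u v \<Longrightarrow> R u' v' \<Longrightarrow> R (u - u') (v - v')"
    and R_scale: "\<And>c u v. R u v \<Longrightarrow> R (mconst c * u) (mconst c * v)"
    and R_deriv: "\<And>u v. R u v \<Longrightarrow> R (lie_deriv G u) (lie_deriv G v)"
    and R_high: "\<And>u v. ord_ge d u \<Longrightarrow> ord_ge d v \<Longrightarrow> R u v"
begin

lemma invariant_shifted: "R u v \<Longrightarrow> R (shifted \<beta> u) (shifted \<beta> v)"
  unfolding shifted_def by (intro R_diff R_scale R_deriv)

lemma invariant_funpow_shifted: "R u v \<Longrightarrow> R ((shifted \<beta> ^^ k) u) ((shifted \<beta> ^^ k) v)"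
  by (induction k) (simp_all add: invariant_shifted)

text \<open>
  On the weight component for \<open>\<alpha>\<close> the operator \<open>D - \<beta>\<close> is the nonzero scalar \<open>\<alpha> - \<beta>\<close> plus the
  nilpotent operator \<open>D - \<alpha>\<close>. It is inverted by descending induction on the order \<open>e\<close> of the
  pair: \<open>D - \<alpha>\<close> raises the order, and \<open>(\<alpha> - \<beta>) u = (D - \<beta>) u - (D - \<alpha>) u\<close>.
\<close>

lemma invariant_cancel_shifted:
  assumes "\<alpha> \<noteq> \<beta>" and "e \<le> d"
    and "weight_component \<mu> \<alpha> u = u" "weight_component \<mu> \<alpha> v = v"
    and "ord_ge e u" "ord_ge e v"
    and "R (shifted \<beta> u) (shifted \<beta> v)"
  shows "R u v"
  using assms(2-)
proof (induction e arbitrary: u v rule: inc_induct)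
  case base
  then show ?case
    by (simp add: R_high)
next
  case (step e)
  have "R (shifted \<alpha> u) (shifted \<alpha> v)"
  proof (rule step.IH)
    show "R (shifted \<beta> (shifted \<alpha> u)) (shifted \<beta> (shifted \<alpha> v))"
      using invariant_shifted[OF step.prems(5), of \<alpha>] by (simp add: shifted_commute)
  qed (use step.prems in \<open>simp_all add: weight_component_shifted ord_ge_Suc_shifted\<close>)
  then have "R (shifted \<beta> u - shifted \<alpha> u) (shifted \<beta> v - shifted \<alpha> v)"
    using step.prems(5) by (rule R_diff[rotated])
  moreover have "shifted \<beta> w - shifted \<alpha> w = mconst (\<alpha> - \<beta>) * w" for w
    by (rule mfps_eqI, simp add: shifted_def) (simp add: algebra_simps)
  ultimately have "R (mconst (1 / (\<alpha> - \<beta>)) * (mconst (\<alpha> - \<beta>) * u))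
      (mconst (1 / (\<alpha> - \<beta>)) * (mconst (\<alpha> - \<beta>) * v))"
    by (simp add: R_scale)
  then show ?case
    using \<open>\<alpha> \<noteq> \<beta>\<close> by (simp flip: mult.assoc mconst_mult)
qed

lemma invariant_cancel_funpow_shifted:
  assumes "\<alpha> \<noteq> \<beta>"
    and "weight_component \<mu> \<alpha> u = u" "weight_component \<mu> \<alpha> v = v"
    and "R ((shifted \<beta> ^^ k) u) ((shifted \<beta> ^^ k) v)"
  shows "R u v"
  using assms(4)
proof (induction k)
  case (Suc k)
  have "R ((shifted \<beta> ^^ k) u) ((shifted \<beta> ^^ k) v)"
    by (rule invariant_cancel_shifted[of \<alpha> \<beta> 0]) (use Suc.prems assms(1-3) in \<open>simp_all add: weight_component_funpow_shifted\<close>)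
  then show ?case
    by (rule Suc.IH)
qed simp

text \<open>
  The power \<open>(D - \<beta>)\<^sup>d\<close> removes the component for \<open>\<beta>\<close> up to order \<open>d\<close>, which leaves fewer
  components, and can be cancelled from the others.
\<close>

lemma invariant_weight_components:
  assumes "finite E"
    and "R (\<Sum>\<alpha>\<in>E. weight_component \<mu> \<alpha> u) (\<Sum>\<alpha>\<in>E. weight_component \<mu> \<alpha> v)"
    and "\<alpha> \<in> E"
  shows "R (weight_component \<mu> \<alpha> u) (weight_component \<mu> \<alpha> v)"
  using assms
proof (induction E arbitrary: u v \<alpha> rule: finite_induct)
  case (insert \<beta> E)
  define S where "S = (\<lambda>w. (shifted \<beta> ^^ d) w)"
  have S_comp: "weight_component \<mu> \<gamma> (S w) = S (weight_component \<mu> \<gamma> w)" for \<gamma> w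
    by (simp add: S_def weight_component_funpow_shifted)
  have S_\<beta>: "ord_ge d (S (weight_component \<mu> \<beta> w))" for w
    unfolding S_def by (rule ord_ge_funpow_shifted) (rule weight_component_idem)
  have S_sum: "S (\<Sum>\<gamma>\<in>insert \<beta> E. weight_component \<mu> \<gamma> w) - S (weight_component \<mu> \<beta> w) =
      (\<Sum>\<gamma>\<in>E. weight_component \<mu> \<gamma> (S w))" for w
    unfolding S_comp unfolding S_def funpow_shifted_sum using insert.hyps by simp
  have "R (S (\<Sum>\<gamma>\<in>insert \<beta> E. weight_component \<mu> \<gamma> u))
      (S (\<Sum>\<gamma>\<in>insert \<beta> E. weight_component \<mu> \<gamma> v))"
    unfolding S_def by (rule invariant_funpow_shifted[OF insert.prems(1)])
  from R_diff[OF this R_high[OF S_\<beta>[of u] S_\<beta>[of v]]]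
  have "R (\<Sum>\<gamma>\<in>E. weight_component \<mu> \<gamma> (S u)) (\<Sum>\<gamma>\<in>E. weight_component \<mu> \<gamma> (S v))"
    unfolding S_sum .
  then have "R (S (weight_component \<mu> \<gamma> u)) (S (weight_component \<mu> \<gamma> v))" if "\<gamma> \<in> E" for \<gamma>
    using insert.IH that by (simp flip: S_comp)
  then have S: "R ((shifted \<beta> ^^ d) (weight_component \<mu> \<gamma> u)) ((shifted \<beta> ^^ d) (weight_component \<mu> \<gamma> v))"
    if "\<gamma> \<in> E" for \<gamma>
    using that unfolding S_def .
  have E: "R (weight_component \<mu> \<gamma> u) (weight_component \<mu> \<gamma> v)" if "\<gamma> \<in> E" for \<gamma>
  proof (rule invariant_cancel_funpow_shifted[OF _ weight_component_idem weight_component_idem S[OF that]])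
    show "\<gamma> \<noteq> \<beta>"
      using that insert.hyps(2) by blast
  qed
  have R_diff_sum: "R (w - sum f F) (z - sum g F)"
    if "finite F" "R w z" "\<And>\<gamma>. \<gamma> \<in> F \<Longrightarrow> R (f \<gamma>) (g \<gamma>)"
    for w z f g and F :: "complex set"
    using that
  proof (induction F rule: finite_induct)
    case (insert \<gamma> F)
    have "R (w - sum f F - f \<gamma>) (z - sum g F - g \<gamma>)"
      by (rule R_diff[OF insert.IH]) (simp_all add: insert.prems)
    moreover have "y - sum h F - h \<gamma> = y - sum h (insert \<gamma> F)"
      for y and h :: "complex \<Rightarrow> (complex, 'n) mfps"
      using insert.hyps by simp
    ultimately show ?case
      by (simp only:)
  qed simp
  have diff_E: "(\<Sum>\<gamma>\<in>insert \<beta> E. h \<gamma>) - (\<Sum>\<gamma>\<in>E. h \<gamma>) = h \<beta>"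
    for h :: "complex \<Rightarrow> (complex, 'n) mfps"
    using insert.hyps by simp
  have "R (weight_component \<mu> \<beta> u) (weight_component \<mu> \<beta> v)"
    using R_diff_sum[where f = "\<lambda>\<gamma>. weight_component \<mu> \<gamma> u"
        and g = "\<lambda>\<gamma>. weight_component \<mu> \<gamma> v", OF insert.hyps(1) insert.prems(1) E]
    unfolding diff_E .
  with E insert.prems(2) show ?case
    by blast
qed simp

end

text \<open>
  The hypothesis says \<open>D(f/g) = 0\<close>, so the pairs \<open>(u, v)\<close> with \<open>u g = f v\<close> are invariant under
  \<open>D\<close>. After adding all pairs of order at least \<open>d\<close>, the weight components of \<open>(f, g)\<close> belong
  to this space, hence so does \<open>(A f, A g)\<close>, which up to order \<open>d\<close> is a finite linear
  combination of them. As \<open>d\<close> is arbitrary, \<open>(A f) g = f (A g)\<close>.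
\<close>

lemma first_integral_of_linear_part:
  assumes "g \<noteq> 0"
    and "lie_deriv G f * g = f * lie_deriv G g"
  shows "lie_deriv (diag_field \<mu>) f * g = f * lie_deriv (diag_field \<mu>) g"
proof -
  define A where "A = lie_deriv (diag_field \<mu>)"
  define L where "L = lie_deriv G"
  define R0 where "R0 u v \<longleftrightarrow> u * g = f * v" for u v
  have R0_deriv: "R0 (L u) (L v)" if "R0 u v" for u v
  proof -
    have uv: "u * g = f * v"
      using that by (simp add: R0_def)
    have "g * (u * L g) = (u * g) * L g"
      by (simp only: mult_ac)
    also have "\<dots> = v * (f * L g)"
      unfolding uv by (simp only: mult_ac)
    also have "\<dots> = v * (L f * g)"
      using assms(2) by (simp only: L_def)
    also have "\<dots> = g * (L f * v)"
      by (simp only: mult_ac)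
    finally have "u * L g = L f * v"
      using \<open>g \<noteq> 0\<close> by simp
    moreover have "L u * g + u * L g = L f * v + f * L v"
      using arg_cong[OF uv, of L] by (simp only: L_def lie_deriv_mult)
    ultimately show ?thesis
      by (simp add: R0_def)
  qed
  have "ord_ge d (A f * g - f * A g)" for d
  proof -
    define R where "R u v \<longleftrightarrow> (\<exists>u' v'. R0 u' v' \<and> ord_ge d (u - u') \<and> ord_ge d (v - v'))" for u v
    have R_diff: "R (u - u') (v - v')" if 1: "R u v" and 2: "R u' v'" for u v u' v'
    proof -
      obtain a b where ab: "R0 a b" "ord_ge d (u - a)" "ord_ge d (v - b)"
        using 1 unfolding R_def by blast
      obtain a' b' where ab': "R0 a' b'" "ord_ge d (u' - a')" "ord_ge d (v' - b')"
        using 2 unfolding R_def by blast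
      have "R0 (a - a') (b - b')"
        using ab(1) ab'(1) by (simp add: R0_def algebra_simps)
      moreover have "ord_ge d (u - u' - (a - a'))" "ord_ge d (v - v' - (b - b'))"
        using ord_ge_diff[OF ab(2) ab'(2)] ord_ge_diff[OF ab(3) ab'(3)]
        by (simp_all add: algebra_simps)
      ultimately show ?thesis
        unfolding R_def by blast
    qed
    have R_scale: "R (mconst c * u) (mconst c * v)" if 1: "R u v" for c u v
    proof -
      obtain a b where ab: "R0 a b" "ord_ge d (u - a)" "ord_ge d (v - b)"
        using 1 unfolding R_def by blast
      then have "R0 (mconst c * a) (mconst c * b)"
        by (simp add: R0_def mult.assoc mult.left_commute)
      moreover have "ord_ge d (mconst c * u - mconst c * a)" "ord_ge d (mconst c * v - mconst c * b)"
        using ab(2,3) by (simp_all add: ord_ge_mult_left flip: right_diff_distrib)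
      ultimately show ?thesis
        unfolding R_def by blast
    qed
    have R_deriv: "R (lie_deriv G u) (lie_deriv G v)" if 1: "R u v" for u v
    proof -
      obtain a b where ab: "R0 a b" "ord_ge d (u - a)" "ord_ge d (v - b)"
        using 1 unfolding R_def by blast
      have "R0 (L a) (L b)"
        using ab(1) by (rule R0_deriv)
      moreover have "ord_ge d (L u - L a)" "ord_ge d (L v - L b)"
        using ord_ge_lie_deriv[OF ord_ge_1_field] ab(2,3)
        by (simp_all add: L_def flip: lie_deriv_diff)
      ultimately show ?thesis
        unfolding R_def L_def by blast
    qed
    have R_high: "R u v" if "ord_ge d u" "ord_ge d v" for u v
      unfolding R_def using that by (intro exI[of _ 0]) (simp add: R0_def)
    define E where "E = weight \<mu> ` {m. mdeg m \<le> d}"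
    have finE: "finite E"
      by (simp add: E_def finite_mdeg_le)
    have recombine: "ord_ge d (B - (\<Sum>\<alpha>\<in>E. mconst (c \<alpha>) * weight_component \<mu> \<alpha> w))"
      if B: "\<And>m. mcoeff B m = c (weight \<mu> m) * mcoeff w m" for B w c
      unfolding ord_ge_def
    proof (intro allI impI)
      fix m :: "nat ^ 'n" assume m: "mdeg m < d"
      have "mcoeff (\<Sum>\<alpha>\<in>E. mconst (c \<alpha>) * weight_component \<mu> \<alpha> w) m =
          (\<Sum>\<alpha>\<in>E. if \<alpha> = weight \<mu> m then c (weight \<mu> m) * mcoeff w m else 0)"
        unfolding mcoeff_sum by (rule sum.cong) (auto simp: mcoeff_weight_component)
      also have "\<dots> = mcoeff B m"
        using m finE by (simp add: B E_def)
      finally show "mcoeff (B - (\<Sum>\<alpha>\<in>E. mconst (c \<alpha>) * weight_component \<mu> \<alpha> w)) m = 0"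
        by simp
    qed
    have approx: "ord_ge d (w - (\<Sum>\<alpha>\<in>E. weight_component \<mu> \<alpha> w))" for w
      using recombine[of w "\<lambda>_. 1" w] by simp
    have approx_A: "ord_ge d (A w - (\<Sum>\<alpha>\<in>E. mconst \<alpha> * weight_component \<mu> \<alpha> w))" for w
      by (rule recombine) (simp add: A_def mcoeff_lie_deriv_diag_field)
    have approx': "ord_ge d ((\<Sum>\<alpha>\<in>E. weight_component \<mu> \<alpha> w) - w)" for w
      using approx[of w] by (simp add: ord_ge_def)
    have R_approx: "R u v"
      if "ord_ge d (u - u')" "ord_ge d (v - v')" "R u' v'" for u u' v v'
    proof -
      have "R (u - u' - (0 - u')) (v - v' - (0 - v'))"
        using R_diff[OF R_high[OF that(1,2)]
          R_diff[OF R_high[OF ord_ge_zero ord_ge_zero] that(3)]] .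
      then show ?thesis
        by simp
    qed
    have "R f g"
      unfolding R_def by (rule exI[of _ f], rule exI[of _ g]) (simp add: R0_def)
    then have sums: "R (\<Sum>\<alpha>\<in>E. weight_component \<mu> \<alpha> f) (\<Sum>\<alpha>\<in>E. weight_component \<mu> \<alpha> g)"
      by (rule R_approx[rotated 2]) (rule approx'[of f], rule approx'[of g])
    have comp: "R (weight_component \<mu> \<alpha> f) (weight_component \<mu> \<alpha> g)" if "\<alpha> \<in> E" for \<alpha>
      by (rule invariant_weight_components[where R = R and d = d and E = E])
         (fact R_diff R_scale R_deriv R_high finE sums that)+
    have R_sum: "R (sum a F) (sum b F)" if "finite F" "\<And>\<alpha>. \<alpha> \<in> F \<Longrightarrow> R (a \<alpha>) (b \<alpha>)"
      for a b and F :: "complex set"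
      using that
    proof (induction F rule: finite_induct)
      case empty
      then show ?case by (simp add: R_high)
    next
      case (insert \<alpha> F)
      have "R (sum a F) (sum b F)"
        by (rule insert.IH) (simp add: insert.prems)
      moreover have "R (a \<alpha>) (b \<alpha>)"
        by (simp add: insert.prems)
      ultimately have "R (a \<alpha> - (0 - sum a F)) (b \<alpha> - (0 - sum b F))"
        using R_diff[OF _ R_diff[OF R_high[OF ord_ge_zero ord_ge_zero]]] by simp
      with insert.hyps show ?case
        by simp
    qed
    have "R (A f) (A g)"
      by (rule R_approx[OF approx_A approx_A]) (rule R_sum[OF finE], rule R_scale, rule comp)
    then obtain u v where uv: "u * g = f * v" "ord_ge d (A f - u)" "ord_ge d (A g - v)"
      unfolding R_def R0_def by blast
    have "A f * g - f * A g = (A f - u) * g - f * (A g - v)"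
      by (simp only: left_diff_distrib right_diff_distrib uv(1) diff_diff_eq2 diff_add_cancel)
    also have "ord_ge d \<dots>"
      by (intro ord_ge_diff ord_ge_mult_left ord_ge_mult_right uv)
    finally show ?thesis .
  qed
  then have "A f * g - f * A g = 0"
    by (rule ord_ge_all_imp_zero)
  then show ?thesis
    unfolding A_def by (simp only: right_minus_eq)
qed

end

section \<open>Extension of ring homomorphisms to determinants and fractions\<close>

definition ring_hom1 :: "('a::comm_ring_1 \<Rightarrow> 'b::comm_ring_1) \<Rightarrow> bool" where
  "ring_hom1 \<phi> \<longleftrightarrow> \<phi> 1 = 1 \<and> (\<forall>x y. \<phi> (x + y) = \<phi> x + \<phi> y) \<and> (\<forall>x y. \<phi> (x * y) = \<phi> x * \<phi> y)"

context
  fixes \<phi> :: "'a::comm_ring_1 \<Rightarrow> 'b::comm_ring_1"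
  assumes hom: "ring_hom1 \<phi>"
begin

lemma ring_hom1_1: "\<phi> 1 = 1"
  and ring_hom1_add: "\<phi> (x + y) = \<phi> x + \<phi> y"
  and ring_hom1_mult: "\<phi> (x * y) = \<phi> x * \<phi> y"
  using hom by (simp_all add: ring_hom1_def)

lemma ring_hom1_0: "\<phi> 0 = 0"
  using ring_hom1_add[of 0 0] by simp

lemma ring_hom1_uminus: "\<phi> (- x) = - \<phi> x"
  using ring_hom1_add[of x "- x"] ring_hom1_0 by (simp add: eq_neg_iff_add_eq_0 add.commute)

lemma ring_hom1_sum: "\<phi> (sum f I) = (\<Sum>i\<in>I. \<phi> (f i))"
  by (induction I rule: infinite_finite_induct) (simp_all add: ring_hom1_0 ring_hom1_add)

lemma ring_hom1_prod: "\<phi> (prod f I) = (\<Prod>i\<in>I. \<phi> (f i))"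
  by (induction I rule: infinite_finite_induct) (simp_all add: ring_hom1_1 ring_hom1_mult)

lemma ring_hom1_det:
  fixes M :: "'a ^ 'n ^ 'n"
  shows "det (\<chi> i j. \<phi> (M $ i $ j)) = \<phi> (det M)"
  unfolding det_def ring_hom1_sum ring_hom1_mult ring_hom1_prod
  by (intro sum.cong refl) (auto simp: sign_def ring_hom1_1 ring_hom1_uminus)

end

text \<open>
  The homomorphism of fraction fields induced by an injective homomorphism \<open>\<phi>\<close> of integral
  domains. It is defined through a chosen representative because a lifted definition would
  need the injectivity for its well-definedness.
\<close>

definition fract_map :: "('a::idom \<Rightarrow> 'b::idom) \<Rightarrow> 'a fract \<Rightarrow> 'b fract" where
  "fract_map \<phi> q = (let (a, b) = SOME (a, b). b \<noteq> 0 \<and> q = Fract a b in Fract (\<phi> a) (\<phi> b))"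

lemma fract_map_Fract:
  assumes hom: "ring_hom1 \<phi>" and inj: "\<And>x. \<phi> x = 0 \<Longrightarrow> x = 0" and "b \<noteq> 0"
  shows "fract_map \<phi> (Fract a b) = Fract (\<phi> a) (\<phi> b)"
proof -
  define P where "P = (\<lambda>(a', b'). b' \<noteq> 0 \<and> Fract a b = Fract a' b')"
  obtain a' b' where ab: "(SOME p. P p) = (a', b')"
    by fastforce
  have "P (a, b)"
    using \<open>b \<noteq> 0\<close> by (simp add: P_def)
  then have "P (a', b')"
    using ab someI[of P] by metis
  then have "b' \<noteq> 0" "a * b' = a' * b"
    using \<open>b \<noteq> 0\<close> by (auto simp: P_def eq_fract)
  then have "\<phi> b' \<noteq> 0" "\<phi> b \<noteq> 0" "\<phi> a * \<phi> b' = \<phi> a' * \<phi> b"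
    using inj \<open>b \<noteq> 0\<close> by (auto simp flip: ring_hom1_mult[OF hom])
  moreover have "fract_map \<phi> (Fract a b) = Fract (\<phi> a') (\<phi> b')"
    using ab by (simp add: fract_map_def P_def)
  ultimately show ?thesis
    by (simp add: eq_fract)
qed

lemma ring_hom1_fract_map:
  assumes hom: "ring_hom1 \<phi>" and inj: "\<And>x. \<phi> x = 0 \<Longrightarrow> x = 0"
  shows "ring_hom1 (fract_map \<phi>)"
proof -
  note F = fract_map_Fract[OF hom inj]
  have nz: "\<phi> b \<noteq> 0" if "b \<noteq> 0" for b
    using that inj by blast
  have "fract_map \<phi> 1 = 1"
    unfolding One_fract_def by (simp add: F ring_hom1_1[OF hom])
  moreover have "fract_map \<phi> (x + y) = fract_map \<phi> x + fract_map \<phi> y" for x y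
    by (cases x; cases y) (simp add: F nz ring_hom1_add[OF hom] ring_hom1_mult[OF hom])
  moreover have "fract_map \<phi> (x * y) = fract_map \<phi> x * fract_map \<phi> y" for x y
    by (cases x; cases y) (simp add: F ring_hom1_mult[OF hom])
  ultimately show ?thesis
    by (simp add: ring_hom1_def)
qed

lemma ring_hom1_field_nonzero:
  fixes \<phi> :: "'a::field \<Rightarrow> 'b::field"
  assumes "ring_hom1 \<phi>" "x \<noteq> 0"
  shows "\<phi> x \<noteq> 0"
proof
  assume "\<phi> x = 0"
  then have "\<phi> (x * inverse x) = 0"
    by (simp add: ring_hom1_mult[OF assms(1)])
  with assms show False
    by (simp add: ring_hom1_1)
qed

abbreviation to_fract :: "'a::idom \<Rightarrow> 'a fract" where
  "to_fract a \<equiv> Fract a 1"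

lemma ring_hom1_to_fract: "ring_hom1 to_fract"
  by (simp add: ring_hom1_def One_fract_def)

lemma to_fract_eq_0_iff: "to_fract a = 0 \<longleftrightarrow> a = 0"
  by (simp add: Zero_fract_def eq_fract)


section \<open>Linear algebra over a field\<close>

lemma matrix_mult_component: "(A ** B) $ i $ j = (\<Sum>k\<in>UNIV. A $ i $ k * B $ k $ j)"
  by (simp add: matrix_matrix_mult_def)

text \<open>
  The given vectors are extended to a basis, whose elements are the rows of \<open>M\<close>; \<open>\<iota>\<close> records
  the position of each vector. Invertibility is a form of independence that survives field
  homomorphisms, and the columns of \<open>N\<close> provide the dual basis.
\<close>

lemma extend_to_invertible_matrix:
  fixes b :: "nat \<Rightarrow> 'a::field ^ 'n::finite"
  assumes "inj_on b {1..r}" and "vec.independent (b ` {1..r})"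
  obtains M N :: "'a ^ 'n ^ 'n" and \<iota> :: "nat \<Rightarrow> 'n"
  where "inj_on \<iota> {1..r}" "\<And>k. k \<in> {1..r} \<Longrightarrow> M $ \<iota> k = b k" "M ** N = mat 1" "N ** M = mat 1"
proof -
  obtain C where C: "b ` {1..r} \<subseteq> C" "vec.independent C" "vec.span C = UNIV"
    using vec.maximal_independent_subset_extend[of "b ` {1..r}" UNIV] assms(2)
    by (metis subset_UNIV top.extremum_uniqueI)
  have "finite C" "card C = CARD('n)"
    using C vec.finiteI_independent vec.dim_eq_card_independent vec.dim_span vec.dim_UNIV
    by (metis vec.dimension_def vec_dim_card)+
  then obtain \<rho> where \<rho>: "bij_betw \<rho> (UNIV :: 'n set) C"
    using finite_same_card_bij[of "UNIV :: 'n set" C] by auto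
  define M :: "'a ^ 'n ^ 'n" where "M = (\<chi> i. \<rho> i)"
  have "\<exists>N. M ** N = mat 1"
    unfolding matrix_right_invertible_independent_rows
  proof (intro allI impI)
    fix c i assume 0: "(\<Sum>i\<in>UNIV. c i *s row i M) = 0"
    have "(\<Sum>x\<in>C. c (inv_into UNIV \<rho> x) *s x) = (\<Sum>i\<in>UNIV. c (inv_into UNIV \<rho> (\<rho> i)) *s \<rho> i)"
      using \<rho> by (rule sum.reindex_bij_betw[symmetric])
    also have "\<dots> = (\<Sum>i\<in>UNIV. c i *s row i M)"
      using \<rho> by (intro sum.cong) (auto simp: M_def row_def bij_betw_def vec_eq_iff)
    finally have "c (inv_into UNIV \<rho> x) = 0" if "x \<in> C" for x
      using vec.independentD[OF C(2) \<open>finite C\<close> subset_refl, of "\<lambda>x. c (inv_into UNIV \<rho> x)"] 0 that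
      by simp
    from this[of "\<rho> i"] show "c i = 0"
      using \<rho> by (auto simp: bij_betw_def)
  qed
  then obtain N where "M ** N = mat 1" ..
  moreover define \<iota> where "\<iota> k = inv_into UNIV \<rho> (b k)" for k
  have row: "M $ \<iota> k = b k" if "k \<in> {1..r}" for k
    using that C(1) \<rho> by (auto simp: M_def \<iota>_def bij_betw_def f_inv_into_f image_subset_iff)
  moreover have "inj_on \<iota> {1..r}"
    using row assms(1) by (metis inj_on_def)
  moreover have "N ** M = mat 1"
    using \<open>M ** N = mat 1\<close> by (rule matrix_left_right_inverse1)
  ultimately show thesis
    using that by blast
qed

lemma independent_family_if_dim_eq:
  fixes b :: "nat \<Rightarrow> 'a::field ^ 'n::finite"
  assumes "vec.dim (b ` {1..r}) = r"
  shows "inj_on b {1..r}" "vec.independent (b ` {1..r})"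
proof -
  obtain B where B: "B \<subseteq> b ` {1..r}" "vec.independent B" "card B = r"
    using vec.basis_exists[of "b ` {1..r}"] assms by metis
  have "card (b ` {1..r}) \<le> r"
    using card_image_le[of "{1..r}" b] by simp
  with B have "B = b ` {1..r}"
    by (intro card_seteq) auto
  with B show "inj_on b {1..r}" "vec.independent (b ` {1..r})"
    by (auto intro: eq_card_imp_inj_on)
qed

lemma independent_family_if_dual:
  fixes a d :: "nat \<Rightarrow> 'a::field ^ 'n::finite"
  assumes dual: "\<And>k l. k \<in> {1..s} \<Longrightarrow> l \<in> {1..s} \<Longrightarrow>
    (\<Sum>j\<in>UNIV. d l $ j * a k $ j) = (if k = l then 1 else 0)"
  shows "inj_on a {1..s}" and "vec.independent (a ` {1..s})"
proof -
  show inj: "inj_on a {1..s}"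
  proof (rule inj_onI)
    fix k l assume "k \<in> {1..s}" "l \<in> {1..s}" "a k = a l"
    then show "k = l"
      using dual[of k k] dual[of l k] by (metis zero_neq_one)
  qed
  show "vec.independent (a ` {1..s})"
  proof (rule vec.independent_if_scalars_zero)
    fix f x
    assume 0: "(\<Sum>x\<in>a ` {1..s}. f x *s x) = 0" and "x \<in> a ` {1..s}"
    then obtain l where l: "l \<in> {1..s}" "x = a l"
      by auto
    have "(\<Sum>k\<in>{1..s}. f (a k) *s a k) = 0"
      using 0 unfolding sum.reindex[OF inj] comp_def .
    then have "0 = (\<Sum>j\<in>UNIV. d l $ j * (\<Sum>k\<in>{1..s}. f (a k) *s a k) $ j)"
      by simp
    also have "\<dots> = (\<Sum>j\<in>UNIV. \<Sum>k\<in>{1..s}. f (a k) * (d l $ j * a k $ j))"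
      by (simp add: sum_component sum_distrib_left mult.left_commute)
    also have "\<dots> = (\<Sum>k\<in>{1..s}. f (a k) * (\<Sum>j\<in>UNIV. d l $ j * a k $ j))"
      by (subst sum.swap) (simp add: sum_distrib_left)
    also have "\<dots> = (\<Sum>k\<in>{1..s}. if k = l then f (a l) else 0)"
      using l(1) by (intro sum.cong) (auto simp: dual)
    also have "\<dots> = f x"
      using l by simp
    finally show "f x = 0"
      by simp
  qed simp
qed

lemma dim_vanishing_coordinates_le:
  fixes P :: "'a::field ^ 'n ^ 'n::finite"
  assumes "invertible P"
  shows "vec.dim {v. \<forall>i\<in>J. (P *v v) $ i = 0} \<le> card (- J)"
proof -
  obtain Q where Q: "Q ** P = mat 1"
    using assms by (auto simp: invertible_def)
  have "{v. \<forall>i\<in>J. (P *v v) $ i = 0} \<subseteq> vec.span ((\<lambda>i. column i Q) ` (- J))"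
  proof safe
    fix v assume v: "\<forall>i\<in>J. (P *v v) $ i = 0"
    define w where "w = P *v v"
    have "v = Q *v w"
      by (simp add: w_def matrix_vector_mul_assoc Q)
    also have "\<dots> = (\<Sum>i\<in>UNIV. w $ i *s column i Q)"
      by (rule matrix_mult_sum)
    also have "\<dots> = (\<Sum>i\<in>- J. w $ i *s column i Q)"
      by (rule sum.mono_neutral_right) (use v in \<open>auto simp: w_def\<close>)
    also have "\<dots> \<in> vec.span ((\<lambda>i. column i Q) ` (- J))"
      by (intro vec.span_sum vec.span_scale vec.span_base) auto
    finally show "v \<in> vec.span ((\<lambda>i. column i Q) ` (- J))" .
  qed
  then have "vec.dim {v. \<forall>i\<in>J. (P *v v) $ i = 0} \<le> card ((\<lambda>i. column i Q) ` (- J))"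
    by (rule vec.dim_le_card) simp
  also have "\<dots> \<le> card (- J)"
    by (rule card_image_le) simp
  finally show ?thesis .
qed

section \<open>First integrals under a formal transformation\<close>

lemma ring_hom1_constant_coeff: "ring_hom1 (\<lambda>f :: ('a::comm_ring_1, 'n::finite) mfps. mcoeff f 0)"
proof -
  have "msplit (0 :: nat ^ 'n) = {(0, 0)}"
    by (auto simp: msplit_def vec_eq_iff)
  then show ?thesis
    by (simp add: ring_hom1_def mcoeff_one mcoeff_mult)
qed

text \<open>
  The constant term of the Jacobian matrix is the identity matrix.
\<close>

lemma det_Jacobian_nonzero:
  assumes "formal_transformation H"
  shows "det (Jacobian H) \<noteq> 0"
proof -
  have "mcoeff (H $ i) (axis j 1) = mcoeff (mvar i) (axis j 1)" for i j
    using assms by (simp add: formal_transformation_def degree_ge2_def)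
  then have "mcoeff (Jacobian H $ i $ j) 0 = mat 1 $ i $ j" for i j
    by (auto simp: Jacobian_def mcoeff_partial_deriv mvar_def mat_def axis_eq_axis)
  then have "(\<chi> i j. mcoeff (Jacobian H $ i $ j) 0) = mat 1"
    by (simp add: vec_eq_iff)
  then have "mcoeff (det (Jacobian H)) 0 = 1"
    by (simp add: ring_hom1_det[OF ring_hom1_constant_coeff, symmetric])
  then show ?thesis
    by auto
qed

lemma vanishing_substitution_formal_transformation:
  assumes "formal_transformation H"
  shows "vanishing_substitution H"
proof
  fix i
  have "mcoeff (H $ i) 0 = mcoeff (mvar i) 0"
    using assms by (simp add: formal_transformation_def degree_ge2_def)
  moreover have "(0 :: nat ^ 'a) \<noteq> axis i 1"
    by (metis mdeg_0 mdeg_axis zero_neq_one)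
  moreover have "m = 0" if "mdeg m = 0" for m :: "nat ^ 'a"
    using that by (auto simp: mdeg_def vec_eq_iff)
  ultimately show "ord_ge 1 (H $ i)"
    by (auto simp: ord_ge_def mvar_def)
qed

definition subst_fract :: "'n vfield \<Rightarrow> (complex, 'n::finite) mfract \<Rightarrow> (complex, 'n) mfract" where
  "subst_fract H = fract_map (\<lambda>f. msubst f H)"

context
  fixes H :: "'n::finite vfield"
  assumes H: "formal_transformation H"
begin

interpretation vanishing_substitution H
  using H by (rule vanishing_substitution_formal_transformation)

lemma ring_hom1_msubst: "ring_hom1 (\<lambda>f. msubst f H)"
  by (simp add: ring_hom1_def msubst_add msubst_mult)

lemma subst_fract_Fract: "g \<noteq> 0 \<Longrightarrow> subst_fract H (Fract f g) = Fract (msubst f H) (msubst g H)"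
  unfolding subst_fract_def
  by (rule fract_map_Fract[OF ring_hom1_msubst]) (simp_all add: msubst_eq_0_iff[OF H])

lemma ring_hom1_subst_fract: "ring_hom1 (subst_fract H)"
  unfolding subst_fract_def
  by (rule ring_hom1_fract_map[OF ring_hom1_msubst]) (simp add: msubst_eq_0_iff[OF H])

lemma lie_deriv_msubst:
  "lie_deriv X (msubst f H) = (\<Sum>j\<in>UNIV. msubst (partial_deriv j f) H * (Jacobian H *v X) $ j)"
proof -
  have "lie_deriv X (msubst f H) =
      (\<Sum>i\<in>UNIV. \<Sum>j\<in>UNIV. msubst (partial_deriv j f) H * partial_deriv i (H $ j) * X $ i)"
    by (simp add: lie_deriv_def partial_deriv_msubst sum_distrib_right)
  also have "\<dots> = (\<Sum>j\<in>UNIV. \<Sum>i\<in>UNIV. msubst (partial_deriv j f) H * partial_deriv i (H $ j) * X $ i)"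
    by (rule sum.swap)
  finally show ?thesis
    by (simp add: Jacobian_def matrix_vector_mult_def sum_distrib_left mult.assoc)
qed

text \<open>
  By the chain rule, up to the factor \<open>g(H)\<^sup>2\<close> both sides express that \<open>X\<close> annihilates the
  function \<open>f(H)/g(H)\<close>. On the left, its gradient is written as the substituted gradient of
  \<open>f/g\<close> times the Jacobian matrix of \<open>H\<close>, which keeps the independence of several gradients
  visible.
\<close>

lemma subst_first_integral_iff:
  assumes "g \<noteq> 0"
  shows "(\<Sum>i\<in>UNIV. subst_fract H (fract_deriv i (Fract f g)) * to_fract ((Jacobian H *v X) $ i)) = 0 \<longleftrightarrow>
    lie_deriv X (msubst f H) * msubst g H = msubst f H * lie_deriv X (msubst g H)"
proof -
  define d where "d = msubst g H * msubst g H"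
  have d: "d \<noteq> 0"
    using assms by (simp add: d_def msubst_eq_0_iff[OF H])
  define a where "a i = msubst (partial_deriv i f * g - f * partial_deriv i g) H *
    (Jacobian H *v X) $ i" for i
  have "subst_fract H (fract_deriv i (Fract f g)) * to_fract ((Jacobian H *v X) $ i) =
      to_fract (a i) * Fract 1 d" for i
    using assms by (simp add: fract_deriv_Fract subst_fract_Fract a_def d_def msubst_mult)
  then have "(\<Sum>i\<in>UNIV. subst_fract H (fract_deriv i (Fract f g)) * to_fract ((Jacobian H *v X) $ i)) =
      to_fract (\<Sum>i\<in>UNIV. a i) * Fract 1 d"
    by (simp only: ring_hom1_sum[OF ring_hom1_to_fract] sum_distrib_right)
  also have "\<dots> = 0 \<longleftrightarrow> (\<Sum>i\<in>UNIV. a i) = 0"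
    using d by (simp add: to_fract_eq_0_iff) (simp add: Zero_fract_def eq_fract)
  also have "(\<Sum>i\<in>UNIV. a i) =
      lie_deriv X (msubst f H) * msubst g H - msubst f H * lie_deriv X (msubst g H)"
    unfolding lie_deriv_msubst a_def msubst_diff msubst_mult left_diff_distrib sum_subtractf
      sum_distrib_left sum_distrib_right by (simp only: mult_ac)
  finally show ?thesis
    by (simp only: right_minus_eq)
qed

end


section \<open>The normal form over the field of fractions\<close>

text \<open>
  The gradients of the first integrals are completed to an invertible matrix \<open>M\<close>. Substituting
  \<open>H\<close> in \<open>M\<close> and multiplying by the Jacobian matrix of \<open>H\<close> gives an invertible matrix \<open>P\<close>. The
  vectors on which the rows of \<open>P\<close> that come from gradients vanish form a space \<open>U\<close> of dimension
  at most \<open>s\<close>. It contains the normal forms because the first integrals are transformed along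
  with the fields, and it contains their linear parts by \<open>first_integral_of_linear_part\<close>. The
  \<open>s\<close> linear parts are independent, hence span \<open>U\<close>.
\<close>

lemma normal_form_in_span_of_linear_parts:
  fixes \<Lambda> :: "nat \<Rightarrow> complex ^ 'n::finite"
  assumes indep: "inj_on \<Lambda> {1..s}" "vec.independent (\<Lambda> ` {1..s})"
    and H: "formal_transformation H"
    and trans: "\<And>k. k \<in> {1..s} \<Longrightarrow> transforms_to H (F k) (G k)"
    and nf: "simultaneous_normal_form s \<Lambda> G"
    and int: "maximal_meromorphic_integrable s F"
    and l: "l \<in> {1..s}"
  shows "(\<chi> i. to_fract (G l $ i)) \<in>
    vec.span ((\<lambda>k. \<chi> i. to_fract (diag_field (\<Lambda> k) $ i)) ` {1..s})"
proof -
  define emb :: "'n vfield \<Rightarrow> (complex, 'n) mfract ^ 'n" where "emb X = (\<chi> i. to_fract (X $ i))" for X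
  define a where "a k = emb (diag_field (\<Lambda> k))" for k
  interpret \<sigma>: vanishing_substitution H
    using H by (rule vanishing_substitution_formal_transformation)
  obtain r \<psi> where r: "r + s = CARD('n)"
    and \<psi>: "\<And>j. j \<in> {1..r} \<Longrightarrow> common_first_integral s F (\<psi> j)"
    and rank: "vec.dim ((\<lambda>j. gradient (\<psi> j)) ` {1..r}) = r"
    using int unfolding maximal_meromorphic_integrable_def functionally_independent_def
      jacobian_rank_def by metis
  obtain M N :: "(complex, 'n) mfract ^ 'n ^ 'n" and \<iota> :: "nat \<Rightarrow> 'n" where \<iota>: "inj_on \<iota> {1..r}"
    and M: "\<And>j. j \<in> {1..r} \<Longrightarrow> M $ \<iota> j = gradient (\<psi> j)" and MN: "M ** N = mat 1" "N ** M = mat 1"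
    by (rule extend_to_invertible_matrix[OF independent_family_if_dim_eq[OF rank]]) blast
  define P where "P = (\<chi> i j. subst_fract H (M $ i $ j)) ** (\<chi> i j. to_fract (Jacobian H $ i $ j))"
  define U where "U = {v. \<forall>i\<in>\<iota> ` {1..r}. (P *v v) $ i = 0}"
  have "det M * det N = 1"
    using MN(1) by (metis det_mul det_I)
  then have "det M \<noteq> 0"
    by auto
  then have "det P \<noteq> 0"
    using ring_hom1_field_nonzero[OF ring_hom1_subst_fract[OF H]] det_Jacobian_nonzero[OF H]
    by (simp add: P_def det_mul ring_hom1_det[OF ring_hom1_subst_fract[OF H]]
        ring_hom1_det[OF ring_hom1_to_fract] to_fract_eq_0_iff)
  then have "vec.dim U \<le> card (- (\<iota> ` {1..r}))"
    unfolding U_def by (intro dim_vanishing_coordinates_le) (simp add: invertible_det_nz)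
  also have "\<dots> = s"
    using r card_image[OF \<iota>] by (simp add: Compl_eq_Diff_UNIV card_Diff_subset)
  finally have dimU: "vec.dim U \<le> s" .
  have P_row: "(P *v emb X) $ \<iota> j =
      (\<Sum>i\<in>UNIV. subst_fract H (fract_deriv i (\<psi> j)) * to_fract ((Jacobian H *v X) $ i))"
    if "j \<in> {1..r}" for X j
  proof -
    have "(\<chi> i j. to_fract (Jacobian H $ i $ j)) *v emb X = emb (Jacobian H *v X)"
      by (simp add: emb_def matrix_vector_mult_def vec_eq_iff ring_hom1_sum[OF ring_hom1_to_fract])
    then have "P *v emb X = (\<chi> i j. subst_fract H (M $ i $ j)) *v emb (Jacobian H *v X)"
      by (simp add: P_def flip: matrix_vector_mul_assoc)
    then show ?thesis
      using M[OF that] by (simp add: matrix_vector_mult_def emb_def gradient_def)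
  qed
  have mem_U: "emb (G k) \<in> U \<and> a k \<in> U" if k: "k \<in> {1..s}" for k
  proof -
    have "(P *v emb (G k)) $ \<iota> j = 0 \<and> (P *v a k) $ \<iota> j = 0" if j: "j \<in> {1..r}" for j
    proof -
      obtain f g where fg: "\<psi> j = Fract f g" "g \<noteq> 0"
        by (cases "\<psi> j")
      have "(Jacobian H *v G k) $ i = msubst (F k $ i) H" for i
        using trans[OF k] by (simp add: transforms_to_def)
      then have "(P *v emb (G k)) $ \<iota> j =
          (\<Sum>i\<in>UNIV. subst_fract H (fract_deriv i (\<psi> j)) * subst_fract H (to_fract (F k $ i)))"
        unfolding P_row[OF j] by (simp add: subst_fract_Fract[OF H])
      also have "\<dots> = subst_fract H (\<Sum>i\<in>UNIV. fract_deriv i (\<psi> j) * to_fract (F k $ i))"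
        by (simp add: ring_hom1_sum[OF ring_hom1_subst_fract[OF H]]
            ring_hom1_mult[OF ring_hom1_subst_fract[OF H]])
      also have "\<dots> = 0"
        using \<psi>[OF j] k by (simp add: common_first_integral_def ring_hom1_0[OF ring_hom1_subst_fract[OF H]])
      finally have G0: "(P *v emb (G k)) $ \<iota> j = 0" .
      interpret nf: diagonal_normal_form "\<Lambda> k" "G k"
        using nf k by unfold_locales
          (auto simp: simultaneous_normal_form_def commuting_family_def)
      have "lie_deriv (G k) (msubst f H) * msubst g H = msubst f H * lie_deriv (G k) (msubst g H)"
        using G0 unfolding P_row[OF j] fg(1) subst_first_integral_iff[OF H fg(2)] .
      then have "lie_deriv (diag_field (\<Lambda> k)) (msubst f H) * msubst g H =
          msubst f H * lie_deriv (diag_field (\<Lambda> k)) (msubst g H)"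
        using fg(2) by (intro nf.first_integral_of_linear_part) (simp_all add: msubst_eq_0_iff[OF H])
      then have "(P *v a k) $ \<iota> j = 0"
        unfolding a_def P_row[OF j] fg(1) subst_first_integral_iff[OF H fg(2)] .
      with G0 show ?thesis ..
    qed
    then show ?thesis
      by (auto simp: U_def)
  qed
  obtain M' N' :: "complex ^ 'n ^ 'n" and \<iota>' :: "nat \<Rightarrow> 'n" where \<iota>': "inj_on \<iota>' {1..s}"
    and M': "\<And>k. k \<in> {1..s} \<Longrightarrow> M' $ \<iota>' k = \<Lambda> k" and MN': "M' ** N' = mat 1"
    by (rule extend_to_invertible_matrix[OF indep]) blast
  define d where "d q = (\<chi> j. Fract (mconst (N' $ j $ \<iota>' q)) (mvar j))" for q
  \<comment> \<open>The dual family of \<open>\<lambda>\<^sup>(\<^sup>k\<^sup>) \<odot> x\<close> is \<open>d\<close>: the dual basis of the \<open>\<lambda>\<^sup>(\<^sup>k\<^sup>)\<close>, divided by \<open>x\<close>.\<close>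
  have dual: "(\<Sum>j\<in>UNIV. d q $ j * a k $ j) = (if k = q then 1 else 0)"
    if "k \<in> {1..s}" "q \<in> {1..s}" for k q
  proof -
    have "(mvar j :: (complex, 'n) mfps) \<noteq> 0" for j
      by (metis mcoeff_mmonom mcoeff_zero mvar_eq_mmonom one_neq_zero)
    then have "d q $ j * a k $ j = to_fract (mconst (N' $ j $ \<iota>' q)) * to_fract (mconst (\<Lambda> k $ j))" for j
      by (simp add: d_def a_def emb_def diag_field_def eq_fract mult_ac)
    then have "(\<Sum>j\<in>UNIV. d q $ j * a k $ j) =
        to_fract (mconst (\<Sum>j\<in>UNIV. \<Lambda> k $ j * N' $ j $ \<iota>' q))"
      by (simp add: ring_hom1_sum[OF ring_hom1_to_fract] mconst_sum mconst_mult mult.commute)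
    also have "(\<Sum>j\<in>UNIV. \<Lambda> k $ j * N' $ j $ \<iota>' q) = mat 1 $ \<iota>' k $ \<iota>' q"
      using M'[OF that(1)] by (simp flip: MN' add: matrix_mult_component)
    also have "\<dots> = (if k = q then 1 else 0)"
      by (simp add: mat_def inj_on_eq_iff[OF \<iota>' that])
    finally show ?thesis
      by (simp add: fract_collapse)
  qed
  note indep_a = independent_family_if_dual[of s d a, OF dual]
  have "U \<subseteq> vec.span (a ` {1..s})"
  proof (rule vec.card_ge_dim_independent)
    show "vec.dim U \<le> card (a ` {1..s})"
      using dimU indep_a(1) by (simp add: card_image)
  qed (use mem_U indep_a(2) in auto)
  then have "emb (G l) \<in> vec.span (a ` {1..s})"
    using mem_U[OF l] by blast
  then show ?thesis
    by (simp add: a_def[abs_def] emb_def)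
qed


section \<open>Division by the variables\<close>

text \<open>
  The product of all variables other than \<open>x\<^sub>j\<close>. Multiplying a component by it replaces the
  division by \<open>x\<^sub>j\<close>, up to the common factor \<open>x\<^sub>1 \<cdots> x\<^sub>n\<close>.
\<close>

definition monom_without :: "'n \<Rightarrow> ('a::comm_ring_1, 'n::finite) mfps" where
  "monom_without j = mmonom 1 (\<chi> i. if i = j then 0 else 1)"

lemma mvar_mult_monom_without: "mvar j * monom_without j = mmonom 1 (\<chi> i. 1)"
proof -
  have "axis j 1 + (\<chi> i. if i = j then 0 else 1) = ((\<chi> i. 1) :: nat ^ 'b)"
    by (auto simp: vec_eq_iff axis_def)
  then show ?thesis
    by (simp only: monom_without_def mvar_eq_mmonom mmonom_mult mult_1)
qed

text \<open>
  The functional \<open>v \<mapsto> \<Sum>\<^sub>j c\<^sub>j v\<^sub>j / x\<^sub>j\<close> is linear over the field of fractions and maps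
  \<open>\<lambda> \<odot> x\<close> to \<open>\<Sum>\<^sub>j c\<^sub>j \<lambda>\<^sub>j\<close>. Here it is multiplied by \<open>x\<^sub>1 \<cdots> x\<^sub>n\<close>.
\<close>

lemma annihilated_if_in_span_of_linear_parts:
  fixes \<Lambda> :: "nat \<Rightarrow> complex ^ 'n::finite" and X :: "'n vfield"
  assumes "(\<chi> i. to_fract (X $ i)) \<in>
      vec.span ((\<lambda>k. \<chi> i. to_fract (diag_field (\<Lambda> k) $ i)) ` K)"
    and c: "\<And>k. k \<in> K \<Longrightarrow> (\<Sum>j\<in>UNIV. \<Lambda> k $ j * c j) = 0"
  shows "(\<Sum>j\<in>UNIV. mconst (c j) * (monom_without j * X $ j)) = 0"
proof -
  define e where "e j = to_fract (mconst (c j) * monom_without j :: (complex, 'n) mfps)" for j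
  have "(\<Sum>j\<in>UNIV. e j * (\<chi> i. to_fract (X $ i)) $ j) = 0"
    using assms(1)
  proof (rule vec.span_induct)
    show "vec.subspace {v. (\<Sum>j\<in>UNIV. e j * v $ j) = 0}"
      by (rule vec.subspaceI)
         (simp_all add: algebra_simps sum.distrib flip: sum_distrib_left)
    fix v assume "v \<in> (\<lambda>k. \<chi> i. to_fract (diag_field (\<Lambda> k) $ i)) ` K"
    then obtain k where k: "k \<in> K" "v = (\<chi> i. to_fract (diag_field (\<Lambda> k) $ i))"
      by blast
    have "mconst (c j) * monom_without j * (mconst (\<Lambda> k $ j) * mvar j) =
        mconst (\<Lambda> k $ j * c j) * mmonom 1 (\<chi> i. 1)" for j
      unfolding mconst_mult mvar_mult_monom_without[of j, symmetric] by (simp only: mult_ac)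
    then have "(\<Sum>j\<in>UNIV. e j * v $ j) =
        to_fract (mconst (\<Sum>j\<in>UNIV. \<Lambda> k $ j * c j) * mmonom 1 (\<chi> i. 1))"
      by (simp add: k(2) e_def diag_field_def ring_hom1_sum[OF ring_hom1_to_fract] mconst_sum
          sum_distrib_right)
    then show "(\<Sum>j\<in>UNIV. e j * v $ j) = 0"
      by (simp add: c[OF k(1)] fract_collapse)
  qed
  then have "to_fract (\<Sum>j\<in>UNIV. mconst (c j) * (monom_without j * X $ j)) = 0"
    by (simp add: e_def ring_hom1_sum[OF ring_hom1_to_fract] mult.assoc)
  then show ?thesis
    by (simp add: to_fract_eq_0_iff)
qed

text \<open>
  These are the coefficients of \<open>\<Sum>\<^sub>j c\<^sub>j X\<^sub>j / x\<^sub>j = 0\<close>. At a monomial \<open>x\<^sup>q\<close> with nonnegative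
  exponents all summands contribute. At \<open>x\<^sup>p / x\<^sub>i\<close> with \<open>p\<^sub>i = 0\<close> the exponent of \<open>x\<^sub>i\<close> is
  negative, and only the summand for \<open>i\<close> has such monomials.
\<close>

lemma coefficient_relations:
  fixes X :: "'n::finite vfield"
  assumes "(\<Sum>j\<in>UNIV. mconst (c j) * (monom_without j * X $ j)) = 0"
  shows "(\<Sum>j\<in>UNIV. c j * mcoeff (X $ j) (q + axis j 1)) = 0"
    and "p $ i = 0 \<Longrightarrow> c i * mcoeff (X $ i) p = 0"
proof -
  have sum0: "(\<Sum>j\<in>UNIV. c j * mcoeff (monom_without j * X $ j) m) = 0" for m
    using arg_cong[OF assms, of "\<lambda>f. mcoeff f m"] by (simp add: mcoeff_sum)
  have shift: "mcoeff (monom_without j * X $ j) ((\<chi> i. if i = j then 0 else 1) + m) = mcoeff (X $ j) m" for j m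
    by (simp add: monom_without_def mcoeff_mmonom_mult_add)
  have "q + (\<chi> i. 1) = (\<chi> i. if i = j then 0 else 1) + (q + axis j 1)" for j
    by (auto simp: vec_eq_iff axis_def)
  then have "mcoeff (monom_without j * X $ j) (q + (\<chi> i. 1)) = mcoeff (X $ j) (q + axis j 1)" for j
    by (metis shift)
  then show "(\<Sum>j\<in>UNIV. c j * mcoeff (X $ j) (q + axis j 1)) = 0"
    using sum0[of "q + (\<chi> i. 1)"] by simp
  assume p: "p $ i = 0"
  define m where "m = (\<chi> k. if k = i then 0 else 1) + p"
  have "c j * mcoeff (monom_without j * X $ j) m = (if j = i then c i * mcoeff (X $ i) p else 0)" for j
  proof (cases "j = i")
    case True
    then show ?thesis
      by (simp add: m_def shift)
  next
    case False
    then have "m $ i < (\<chi> k. if k = j then 0 else 1) $ i"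
      using p by (simp add: m_def)
    then have "mcoeff (monom_without j * X $ j) m = 0"
      unfolding monom_without_def by (rule mcoeff_mmonom_mult_eq_0)
    with False show ?thesis
      by simp
  qed
  then show "c i * mcoeff (X $ i) p = 0"
    using sum0[of m] by simp
qed

section \<open>Maximal integrability implies Condition AL\<close>

theorem proposition95:
  fixes s :: nat
    and \<Lambda> :: "nat \<Rightarrow> complex ^ 'n"
    and F G :: "nat \<Rightarrow> 'n::finite vfield"
    and H :: "'n vfield"
  assumes "commuting_family s \<Lambda> F"
    and "inj_on \<Lambda> {1..s}" and "vec.independent (\<Lambda> ` {1..s})"
    and "formal_transformation H"
    and "\<And>k. k \<in> {1..s} \<Longrightarrow> transforms_to H (F k) (G k)"
    and "simultaneous_normal_form s \<Lambda> G"
    and "maximal_meromorphic_integrable s F"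
  shows "condition_AL s \<Lambda> G"
proof -
  obtain M N :: "complex ^ 'n ^ 'n" and \<iota> :: "nat \<Rightarrow> 'n" where \<iota>: "inj_on \<iota> {1..s}"
    and M: "\<And>k. k \<in> {1..s} \<Longrightarrow> M $ \<iota> k = \<Lambda> k"
    and MN: "M ** N = mat 1" and NM: "N ** M = mat 1"
    by (rule extend_to_invertible_matrix[OF assms(2,3)]) blast
  have NM_sum: "(\<Sum>i\<in>UNIV. N $ j $ i * M $ i $ k) = (if j = k then 1 else 0)" for j k
    using NM by (simp add: mat_def flip: matrix_mult_component)
  have \<Lambda>N: "(\<Sum>j\<in>UNIV. \<Lambda> k $ j * N $ j $ i) = (if i = \<iota> k then 1 else 0)"
    if "k \<in> {1..s}" for k i
  proof -
    have "(\<Sum>j\<in>UNIV. M $ \<iota> k $ j * N $ j $ i) = (if i = \<iota> k then 1 else 0)"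
      using MN by (auto simp: mat_def simp flip: matrix_mult_component)
    then show ?thesis
      using M[OF that] by simp
  qed
  have annihilated: "(\<Sum>j\<in>UNIV. mconst (N $ j $ i) * (monom_without j * G k $ j)) = 0"
    if "k \<in> {1..s}" "i \<notin> \<iota> ` {1..s}" for k i
    using normal_form_in_span_of_linear_parts[OF assms(2-7) that(1)]
    by (rule annihilated_if_in_span_of_linear_parts) (use \<Lambda>N that(2) in auto)
  \<comment> \<open>The exponent \<open>p\<close> is recovered from its weights: \<open>p\<^sub>i = \<Sum>\<^sub>j N\<^sub>i\<^sub>j \<langle>p, M\<^sub>j\<rangle>\<close>. A nonzero coefficient
  forces \<open>\<langle>p, M\<^sub>j\<rangle> = M\<^sub>j\<^sub>i\<close> whenever \<open>N\<^sub>i\<^sub>j\<close> is not zero, and then the sum is \<open>(N M)\<^sub>i\<^sub>i = 1\<close>, although \<open>p\<^sub>i = 0\<close>.\<close>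
  have divisible: "mcoeff (G k $ i) p = 0" if k: "k \<in> {1..s}" and p: "p $ i = 0" for k i p
  proof (rule ccontr)
    assume nz: "mcoeff (G k $ i) p \<noteq> 0"
    have "N $ i $ i' * weight (M $ i') p = N $ i $ i' * M $ i' $ i" for i'
    proof (cases "i' \<in> \<iota> ` {1..s}")
      case True
      then obtain l where l: "l \<in> {1..s}" "i' = \<iota> l"
        by blast
      have "lie_bracket (diag_field (\<Lambda> l)) (G k) = 0"
        using assms(6) k l(1) by (simp add: simultaneous_normal_form_def)
      then have "weight (\<Lambda> l) p = \<Lambda> l $ i"
        using nz by (rule resonant_if_commutes_diag_field)
      then show ?thesis
        using M l by simp
    next
      case False
      then show ?thesis
        using coefficient_relations(2)[OF annihilated[OF k False] p] nz by simp
    qed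
    then have "(\<Sum>i'\<in>UNIV. N $ i $ i' * weight (M $ i') p) = 1"
      using NM_sum[of i i] by (simp only: refl if_True)
    moreover have "(\<Sum>i'\<in>UNIV. N $ i $ i' * weight (M $ i') p) =
        (\<Sum>j\<in>UNIV. (\<Sum>i'\<in>UNIV. N $ i $ i' * M $ i' $ j) * of_nat (p $ j))"
      unfolding weight_def sum_distrib_left sum_distrib_right
      by (subst sum.swap) (simp add: mult.assoc)
    ultimately show False
      using p by (simp add: NM_sum mult_delta_left)
  qed
  \<comment> \<open>The column \<open>\<iota> i\<close> of \<open>N\<close> reads off the coordinate along \<open>\<lambda>\<^sup>(\<^sup>i\<^sup>)\<close>; it is applied to the vectors of
  coefficients of \<open>(G\<^sub>j / x\<^sub>j)\<^sub>j\<close>.\<close>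
  define w where "w i k = Abs_mfps (\<lambda>q. \<Sum>j\<in>UNIV. N $ j $ \<iota> i * mcoeff (G k $ j) (q + axis j 1))" for i k
  have w0: "mcoeff (w i k) 0 = (if i = k then 1 else 0)" if "i \<in> {1..s}" "k \<in> {1..s}" for i k
  proof -
    have "mcoeff (G k $ j) (axis j 1) = mcoeff (diag_field (\<Lambda> k) $ j) (axis j 1)" for j
      using assms(6) that(2)
      by (simp add: simultaneous_normal_form_def commuting_family_def degree_ge2_def)
    then have "mcoeff (w i k) 0 = (\<Sum>j\<in>UNIV. \<Lambda> k $ j * N $ j $ \<iota> i)"
      by (simp add: w_def diag_field_def mvar_eq_mmonom mcoeff_mmonom mult.commute)
    also have "\<dots> = (if i = k then 1 else 0)"
      unfolding \<Lambda>N[OF that(2)] inj_on_eq_iff[OF \<iota> that] ..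
    finally show ?thesis .
  qed
  have expand: "G k = (\<Sum>i=1..s. w i k *s diag_field (\<Lambda> i))" if k: "k \<in> {1..s}" for k
  proof -
    have summand: "w i k * (mconst (\<Lambda> i $ j) * mvar j) = mmonom (\<Lambda> i $ j) (axis j 1) * w i k" for i j
      by (simp add: mconst_eq_mmonom mvar_eq_mmonom mmonom_mult mult.commute)
    have "mcoeff (G k $ j) m = mcoeff (\<Sum>i=1..s. w i k * (mconst (\<Lambda> i $ j) * mvar j)) m" for j m
    proof (cases "m $ j = 0")
      case True
      have "mcoeff (w i k * (mconst (\<Lambda> i $ j) * mvar j)) m = 0" for i
        unfolding summand by (rule mcoeff_mmonom_mult_eq_0[of _ j]) (simp add: True axis_def)
      with divisible[OF k True] show ?thesis
        by (simp add: mcoeff_sum)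
    next
      case False
      then have "m = axis j 1 + (m - axis j 1)"
        by (auto simp: vec_eq_iff axis_def)
      then obtain q where q: "m = axis j 1 + q" ..
      define u where "u j' = mcoeff (G k $ j') (q + axis j' 1)" for j'
      have perp: "(\<Sum>j'\<in>UNIV. N $ j' $ i * u j') = 0" if "i \<notin> \<iota> ` {1..s}" for i
        using coefficient_relations(1)[OF annihilated[OF k that]] by (simp add: u_def)
      have "mcoeff (w i k * (mconst (\<Lambda> i $ j) * mvar j)) m =
          \<Lambda> i $ j * (\<Sum>j'\<in>UNIV. N $ j' $ \<iota> i * u j')" for i
        unfolding summand q mcoeff_mmonom_mult_add by (simp add: w_def u_def)
      then have "mcoeff (\<Sum>i=1..s. w i k * (mconst (\<Lambda> i $ j) * mvar j)) m =
          (\<Sum>i=1..s. M $ \<iota> i $ j * (\<Sum>j'\<in>UNIV. N $ j' $ \<iota> i * u j'))"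
        by (simp add: mcoeff_sum M)
      also have "\<dots> = (\<Sum>i\<in>\<iota> ` {1..s}. M $ i $ j * (\<Sum>j'\<in>UNIV. N $ j' $ i * u j'))"
        unfolding sum.reindex[OF \<iota>] comp_def ..
      also have "\<dots> = (\<Sum>i\<in>UNIV. M $ i $ j * (\<Sum>j'\<in>UNIV. N $ j' $ i * u j'))"
        by (rule sum.mono_neutral_left) (auto simp: perp)
      also have "\<dots> = (\<Sum>j'\<in>UNIV. (\<Sum>i\<in>UNIV. N $ j' $ i * M $ i $ j) * u j')"
        unfolding sum_distrib_left sum_distrib_right
        by (subst sum.swap) (simp add: mult_ac)
      also have "\<dots> = u j"
        by (simp add: NM_sum mult_delta_left)
      finally show ?thesis
        by (simp add: q u_def add.commute)
    qed
    then show ?thesis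
      by (auto simp: vec_eq_iff diag_field_def intro!: mfps_eqI)
  qed
  define v where "v i k = w i k - (if i = k then 1 else 0)" for i k
  show ?thesis
    unfolding condition_AL_def
  proof (intro exI[of _ v] conjI ballI)
    fix i k assume "i \<in> {1..s}" "k \<in> {1..s}"
    then show "mcoeff (v i k) 0 = 0"
      using w0[of i k] by (auto simp: v_def mcoeff_one)
  next
    fix k assume k: "k \<in> {1..s}"
    show "G k = (\<Sum>i=1..s. ((if i = k then 1 else 0) + v i k) *s diag_field (\<Lambda> i))"
      unfolding expand[OF k] by (simp add: v_def)
  qed
qed

end
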